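(* Let $h=h^*\in A_\theta^\infty$, and let $[t_0,t_1]$ be the smallest closed interval containing the spectrum $\sigma(h)$ of $h$ in $A_\theta$; that is, $t_1=\max\{t:t\in\sigma(h)\}$ and $t_0=\min\{t:t\in\sigma(h)\}$. Then there exists a state $\varphi$ of $A_\theta$ with $\varphi(h)=t_1$, and for every such state $\varphi(\Delta h)\le 0$. Similarly, there exists a state $\psi$ of $A_\theta$ with $\psi(h)=t_0$, and for every such state $\psi(\Delta h)\ge 0$.
   Context: Fix $\theta\in\mathbb R\smallsetminus\mathbb Q$. $A_\theta$ is the (universal) unital $C^*$-algebra generated by two unitaries $U,V$ with $UV=e^{2\pi i\theta}VU$. Its smooth subalgebra is $A_\theta^\infty=\{\sum_{m,n\in\mathbb Z}c_{m,n}U^mV^n: (c_{m,n})\text{ rapidly decreasing}\}$, which is the set of $C^\infty$ vectors for the action of $\mathbb T^2$ on $A_\theta$ by $*$-automorphisms given by $U\mapsto z_1U$, $V\mapsto z_2V$. The commuting derivations $\delta_1,\delta_2$ of $A_\theta^\infty$ are given by $\delta_1(U)=2\pi iU$, $\delta_1(V)=0$, $\delta_2(U)=0$, $\delta_2(V)=2\pi iV$, so $\delta_1(\sum c_{m,n}U^mV^n)=2\pi i\sum m\,c_{m,n}U^mV^n$ and $\delta_2(\sum c_{m,n}U^mV^n)=2\pi i\sum n\,c_{m,n}U^mV^n$. The Laplacian is $\Delta=\delta_1^2+\delta_2^2$. *)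

theory Defs
  imports "HOL-Analysis.Analysis" "HOL-Algebra.Ring"
begin

section \<open>Unital $C^*$-algebras\<close>

class scaleC =
  fixes scaleC :: "complex \<Rightarrow> 'a \<Rightarrow> 'a"  (infixr \<open>*\<^sub>C\<close> 75)

class star =
  fixes star :: "'a \<Rightarrow> 'a"

text \<open>
  A type carrying the structure of a (nonzero) unital $C^*$-algebra. The library classes
  \<^class>\<open>banach\<close> and \<^class>\<open>real_normed_algebra_1\<close> contribute the complete norm with
  $\|xy\| \le \|x\|\,\|y\|$ and $\|1\| = 1$; their real scalar multiplication is the
  restriction of the complex one.
\<close>

class cstar_algebra = banach + real_normed_algebra_1 + scaleC + star +
  assumes scaleC_of_real: "complex_of_real r *\<^sub>C x = r *\<^sub>R x"
    and scaleC_add_right: "a *\<^sub>C (x + y) = a *\<^sub>C x + a *\<^sub>C y"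
    and scaleC_add_left: "(a + b) *\<^sub>C x = a *\<^sub>C x + b *\<^sub>C x"
    and scaleC_scaleC: "a *\<^sub>C b *\<^sub>C x = (a * b) *\<^sub>C x"
    and mult_scaleC_left: "(a *\<^sub>C x) * y = a *\<^sub>C (x * y)"
    and mult_scaleC_right: "x * (a *\<^sub>C y) = a *\<^sub>C (x * y)"
    and norm_scaleC: "norm (a *\<^sub>C x) = cmod a * norm x"
    and star_star: "star (star x) = x"
    and star_add: "star (x + y) = star x + star y"
    and star_mult: "star (x * y) = star y * star x"
    and star_scaleC: "star (a *\<^sub>C x) = cnj a *\<^sub>C star x"
    and cstar_identity: "norm (star x * x) = (norm x)\<^sup>2"

text \<open>
  A universal property quantifies over all $C^*$-algebras, which a type class cannot express
  inside a formula. The same notion is therefore also needed for structures with an explicit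
  carrier; \<open>cstar_of_type\<close> below passes from the first version to the second.
\<close>

record 'a cstar_struct = "'a ring" +
  cscale :: "complex \<Rightarrow> 'a \<Rightarrow> 'a"
  adj :: "'a \<Rightarrow> 'a"
  cnorm :: "'a \<Rightarrow> real"

locale unital_cstar = ring B for B :: "'a cstar_struct" (structure) +
  assumes cscale_closed: "x \<in> carrier B \<Longrightarrow> cscale B a x \<in> carrier B"
    and cscale_one: "x \<in> carrier B \<Longrightarrow> cscale B 1 x = x"
    and cscale_add_right: "\<lbrakk>x \<in> carrier B; y \<in> carrier B\<rbrakk> \<Longrightarrow>
          cscale B a (x \<oplus> y) = cscale B a x \<oplus> cscale B a y"
    and cscale_add_left: "x \<in> carrier B \<Longrightarrow> cscale B (a + b) x = cscale B a x \<oplus> cscale B b x"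
    and cscale_cscale: "x \<in> carrier B \<Longrightarrow> cscale B a (cscale B b x) = cscale B (a * b) x"
    and mult_cscale_left: "\<lbrakk>x \<in> carrier B; y \<in> carrier B\<rbrakk> \<Longrightarrow>
          cscale B a x \<otimes> y = cscale B a (x \<otimes> y)"
    and mult_cscale_right: "\<lbrakk>x \<in> carrier B; y \<in> carrier B\<rbrakk> \<Longrightarrow>
          x \<otimes> cscale B a y = cscale B a (x \<otimes> y)"
    and adj_closed: "x \<in> carrier B \<Longrightarrow> adj B x \<in> carrier B"
    and adj_adj: "x \<in> carrier B \<Longrightarrow> adj B (adj B x) = x"
    and adj_add: "\<lbrakk>x \<in> carrier B; y \<in> carrier B\<rbrakk> \<Longrightarrow> adj B (x \<oplus> y) = adj B x \<oplus> adj B y"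
    and adj_mult: "\<lbrakk>x \<in> carrier B; y \<in> carrier B\<rbrakk> \<Longrightarrow> adj B (x \<otimes> y) = adj B y \<otimes> adj B x"
    and adj_cscale: "x \<in> carrier B \<Longrightarrow> adj B (cscale B a x) = cscale B (cnj a) (adj B x)"
    and cnorm_nonneg: "x \<in> carrier B \<Longrightarrow> 0 \<le> cnorm B x"
    and cnorm_eq_0_iff: "x \<in> carrier B \<Longrightarrow> cnorm B x = 0 \<longleftrightarrow> x = \<zero>"
    and cnorm_triangle: "\<lbrakk>x \<in> carrier B; y \<in> carrier B\<rbrakk> \<Longrightarrow>
          cnorm B (x \<oplus> y) \<le> cnorm B x + cnorm B y"
    and cnorm_cscale: "x \<in> carrier B \<Longrightarrow> cnorm B (cscale B a x) = cmod a * cnorm B x"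
    and cnorm_mult: "\<lbrakk>x \<in> carrier B; y \<in> carrier B\<rbrakk> \<Longrightarrow>
          cnorm B (x \<otimes> y) \<le> cnorm B x * cnorm B y"
    and cnorm_cstar: "x \<in> carrier B \<Longrightarrow> cnorm B (adj B x \<otimes> x) = (cnorm B x)\<^sup>2"
    and cnorm_complete: "\<lbrakk>range s \<subseteq> carrier B;
          \<forall>e>0. \<exists>N. \<forall>m\<ge>N. \<forall>n\<ge>N. cnorm B (s m \<ominus> s n) < e\<rbrakk> \<Longrightarrow>
          \<exists>x\<in>carrier B. (\<lambda>n. cnorm B (s n \<ominus> x)) \<longlonglongrightarrow> 0"

definition cstar_of_type :: "'a::cstar_algebra cstar_struct" where
  "cstar_of_type = \<lparr>carrier = UNIV, mult = (*), one = 1, zero = 0, add = (+),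
     cscale = scaleC, adj = star, cnorm = norm\<rparr>"

lemma unital_cstar_cstar_of_type: "unital_cstar (cstar_of_type :: 'a::cstar_algebra cstar_struct)"
proof -
  let ?B = "cstar_of_type :: 'a cstar_struct"
  interpret ring ?B
  proof (rule ringI)
    show "abelian_group ?B"
      by (rule abelian_groupI)
        (auto simp: cstar_of_type_def algebra_simps intro: exI[of _ "- x" for x] left_minus)
    show "Group.monoid ?B"
      by (rule monoidI) (auto simp: cstar_of_type_def algebra_simps)
  qed (auto simp: cstar_of_type_def algebra_simps)
  have uminus: "\<ominus>\<^bsub>?B\<^esub> x = - x" for x
    by (rule minus_equality[of "- x" x, THEN trans]) (auto simp: cstar_of_type_def)
  have minus: "x \<ominus>\<^bsub>?B\<^esub> y = x - y" for x y
    using uminus by (simp add: a_minus_def cstar_of_type_def)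
  have complete: "\<exists>x\<in>carrier ?B. (\<lambda>n. cnorm ?B (s n \<ominus>\<^bsub>?B\<^esub> x)) \<longlonglongrightarrow> 0"
    if "\<forall>e>0. \<exists>N. \<forall>m\<ge>N. \<forall>n\<ge>N. cnorm ?B (s m \<ominus>\<^bsub>?B\<^esub> s n) < e" for s
  proof -
    have "Cauchy s"
      using that unfolding minus by (auto simp: Cauchy_def dist_norm cstar_of_type_def)
    then obtain x where "s \<longlonglongrightarrow> x"
      using Cauchy_convergent convergent_def by blast
    then have "(\<lambda>n. norm (s n - x)) \<longlonglongrightarrow> 0"
      using LIM_zero tendsto_norm_zero by blast
    then show ?thesis unfolding minus by (auto simp: cstar_of_type_def)
  qed
  have one: "1 *\<^sub>C x = x" for x :: 'a
    using scaleC_of_real[of 1 x] by simp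
  show ?thesis
    by (intro unital_cstar.intro unital_cstar_axioms.intro complete ring_axioms)
      (auto simp: cstar_of_type_def one scaleC_add_right scaleC_add_left scaleC_scaleC
        mult_scaleC_left mult_scaleC_right norm_scaleC star_star star_add star_mult star_scaleC
        cstar_identity norm_triangle_ineq norm_mult_ineq)
qed

definition star_hom :: "'a cstar_struct \<Rightarrow> 'b cstar_struct \<Rightarrow> ('a \<Rightarrow> 'b) set" where
  "star_hom A B = {f \<in> ring_hom A B. \<forall>x\<in>carrier A.
     (\<forall>a. f (cscale A a x) = cscale B a (f x)) \<and> f (adj A x) = adj B (f x)}"

definition unitary_in :: "'a cstar_struct \<Rightarrow> 'a \<Rightarrow> bool" where
  "unitary_in B u \<longleftrightarrow>
     u \<in> carrier B \<and> adj B u \<otimes>\<^bsub>B\<^esub> u = \<one>\<^bsub>B\<^esub> \<and> u \<otimes>\<^bsub>B\<^esub> adj B u = \<one>\<^bsub>B\<^esub>"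

definition star_subalgebra :: "'a::cstar_algebra set \<Rightarrow> bool" where
  "star_subalgebra S \<longleftrightarrow> 1 \<in> S \<and> (\<forall>x\<in>S. \<forall>y\<in>S. x + y \<in> S \<and> x * y \<in> S)
     \<and> (\<forall>x\<in>S. (\<forall>a. a *\<^sub>C x \<in> S) \<and> star x \<in> S)"

definition spectrum :: "'a::cstar_algebra \<Rightarrow> complex set" where
  "spectrum a = {z. \<not> (\<exists>b. b * (z *\<^sub>C 1 - a) = 1 \<and> (z *\<^sub>C 1 - a) * b = 1)}"

text \<open>
  Positive elements are those of the form $a^*a$. For a unital algebra, a positive linear
  functional is automatically bounded with norm its value at 1.
\<close>

definition state :: "('a::cstar_algebra \<Rightarrow> complex) \<Rightarrow> bool" where
  "state \<phi> \<longleftrightarrow> (\<forall>x y. \<phi> (x + y) = \<phi> x + \<phi> y) \<and> (\<forall>a x. \<phi> (a *\<^sub>C x) = a * \<phi> x)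
     \<and> (\<forall>x. \<phi> (star x * x) \<in> \<real> \<and> 0 \<le> Re (\<phi> (star x * x))) \<and> \<phi> 1 = 1"


section \<open>The irrational rotation algebra\<close>

definition rotation_pair :: "real \<Rightarrow> 'a cstar_struct \<Rightarrow> 'a \<Rightarrow> 'a \<Rightarrow> bool" where
  "rotation_pair \<theta> B u v \<longleftrightarrow> unitary_in B u \<and> unitary_in B v
     \<and> u \<otimes>\<^bsub>B\<^esub> v = cscale B (exp (2 * pi * \<i> * \<theta>)) (v \<otimes>\<^bsub>B\<^esub> u)"

text \<open>
  The type \<open>'a\<close>, with generators \<open>U\<close> and \<open>V\<close>, is the universal unital $C^*$-algebra
  $A_\theta$. The test algebras \<open>B\<close> have their carrier inside \<open>'a\<close>, which loses no
  generality: \<open>B\<close> may be replaced by its separable $C^*$-subalgebra generated by \<open>u\<close> and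
  \<open>v\<close>, of cardinality at most that of the continuum, and \<open>'a\<close> is at least that large.
  Uniqueness of \<open>f\<close> follows from generation.
\<close>

definition universal_rotation_algebra :: "real \<Rightarrow> 'a::cstar_algebra \<Rightarrow> 'a \<Rightarrow> bool" where
  "universal_rotation_algebra \<theta> U V \<longleftrightarrow>
     rotation_pair \<theta> cstar_of_type U V
     \<and> \<Inter>{S. closed S \<and> star_subalgebra S \<and> U \<in> S \<and> V \<in> S} = UNIV
     \<and> (\<forall>(B :: 'a cstar_struct) u v. unital_cstar B \<and> rotation_pair \<theta> B u v \<longrightarrow>
          (\<exists>f \<in> star_hom cstar_of_type B. f U = u \<and> f V = v))"

text \<open>Integer powers of a unitary element, whose inverse is its adjoint.\<close>

definition unitary_power :: "'a::cstar_algebra \<Rightarrow> int \<Rightarrow> 'a" where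
  "unitary_power u m = (if 0 \<le> m then u ^ nat m else star u ^ nat (- m))"

definition rapidly_decreasing :: "(int \<Rightarrow> int \<Rightarrow> complex) \<Rightarrow> bool" where
  "rapidly_decreasing c \<longleftrightarrow>
     (\<forall>k::nat. \<exists>C. \<forall>m n. cmod (c m n) * (1 + \<bar>real_of_int m\<bar> + \<bar>real_of_int n\<bar>) ^ k \<le> C)"

definition fourier_sum :: "'a::cstar_algebra \<Rightarrow> 'a \<Rightarrow> (int \<Rightarrow> int \<Rightarrow> complex) \<Rightarrow> 'a" where
  "fourier_sum U V c =
     (\<Sum>\<^sub>\<infinity>(m, n)\<in>UNIV. c m n *\<^sub>C (unitary_power U m * unitary_power V n))"

definition smooth_subalgebra :: "'a::cstar_algebra \<Rightarrow> 'a \<Rightarrow> 'a set" where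
  "smooth_subalgebra U V = {fourier_sum U V c | c. rapidly_decreasing c}"

text \<open>
  The coefficients of a smooth element of $A_\theta$ are unique, and the derivations are only
  meaningful on smooth elements.
\<close>

definition fourier_coeff :: "'a::cstar_algebra \<Rightarrow> 'a \<Rightarrow> 'a \<Rightarrow> int \<Rightarrow> int \<Rightarrow> complex" where
  "fourier_coeff U V a = (THE c. rapidly_decreasing c \<and> fourier_sum U V c = a)"

definition \<delta>\<^sub>1 :: "'a::cstar_algebra \<Rightarrow> 'a \<Rightarrow> 'a \<Rightarrow> 'a" where
  "\<delta>\<^sub>1 U V a = fourier_sum U V (\<lambda>m n. 2 * pi * \<i> * of_int m * fourier_coeff U V a m n)"

definition \<delta>\<^sub>2 :: "'a::cstar_algebra \<Rightarrow> 'a \<Rightarrow> 'a \<Rightarrow> 'a" where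
  "\<delta>\<^sub>2 U V a = fourier_sum U V (\<lambda>m n. 2 * pi * \<i> * of_int n * fourier_coeff U V a m n)"

definition laplacian :: "'a::cstar_algebra \<Rightarrow> 'a \<Rightarrow> 'a \<Rightarrow> 'a" where
  "laplacian U V a = \<delta>\<^sub>1 U V (\<delta>\<^sub>1 U V a) + \<delta>\<^sub>2 U V (\<delta>\<^sub>2 U V a)"

definition smallest_spectral_interval :: "'a::cstar_algebra \<Rightarrow> real \<Rightarrow> real \<Rightarrow> bool" where
  "smallest_spectral_interval h s t \<longleftrightarrow> s \<le> t \<and> spectrum h \<subseteq> complex_of_real ` {s..t}
     \<and> (\<forall>a b. spectrum h \<subseteq> complex_of_real ` {a..b} \<longrightarrow> {s..t} \<subseteq> {a..b})"

end

theory Submission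
  imports Defs
begin

text \<open>
  The torus acts on $A_\theta$ by automorphisms that preserve the set of states, and $h$ attains its
  largest value over all states at $\varphi$; so $\varphi$ composed with the action gives a real
  function on the torus with a maximum at the identity, and $\varphi(\Delta h)$ is the Laplacian of
  this function there.

  In detail, the automorphisms $\alpha_{s,t}$ with $U \mapsto e^{is}U$ and $V \mapsto e^{it}V$ come from
  the universal property. If $\varphi$ is a state, so is $\varphi\circ\alpha_{s,t}$, and states are
  contractive, so for $h = \sum c_{m,n} U^m V^n$ the value of $\varphi\circ\alpha_{s,t}$ at $h$ is
  $\sum c_{m,n}\, e^{i(sm+tn)}\, \varphi(U^m V^n)$. The second derivative in a direction $(p,q)$ is replaced by
  the symmetric second difference, which the rapid decay of $c$ compares with
  $\sum (pm+qn)^2 c_{m,n}\, \varphi(U^m V^n)$ (lemma \<open>second_derivative_at_maximum\<close>). The Laplacian is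
  defined through the Fourier coefficients of an element, so these have to be unique: averaging over
  $N$-th roots of unity and letting $N$ grow isolates one coefficient (\<open>fourier_sum_eq_0\<close>).

  This uses three facts on an arbitrary unital $C^*$-algebra, for self-adjoint $h$ and the least real
  number $M$ for which $M - h$ is positive (\<open>upper_bound\<close>): $M$ is the largest element of the spectrum;
  no state exceeds $M$ at $h$; some state attains $M$. All three rest on a cone of positive elements
  that is defined by norm inequalities alone. A binomial series provides square roots in the cone
  (\<open>positive_sqrt\<close>), and the cone contains every $x^*x$ (\<open>positive_star_mult\<close>). The spectrum is then
  compared with the cone by a Neumann series, and the state attaining $M$ comes from a linear functional
  dominated by a sublinear one (\<open>Hahn_Banach_sublinear\<close>). The statement on the minimum is the statement
  on the maximum for $-h$.
\<close>

section \<open>The involution and complex scalars\<close>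

lemma star_0 [simp]: "star (0::'a::cstar_algebra) = 0"
  using star_add[of 0 "0::'a"] by simp

lemma star_minus: "star (- x) = - star (x::'a::cstar_algebra)"
  using star_add[of x "- x"] by (simp add: add_eq_0_iff)

lemma star_diff: "star (x - y) = star x - star (y::'a::cstar_algebra)"
  using star_add[of x "- y"] by (simp add: star_minus)

lemma star_1 [simp]: "star (1::'a::cstar_algebra) = 1"
  by (metis mult_1 mult.right_neutral star_mult star_star)

lemma star_scaleR: "star (r *\<^sub>R x) = r *\<^sub>R star (x::'a::cstar_algebra)"
  by (metis complex_cnj_complex_of_real scaleC_of_real star_scaleC)

lemma star_of_real [simp]: "star (of_real r) = (of_real r :: 'a::cstar_algebra)"
  by (simp add: of_real_def star_scaleR)

lemma norm_star: "norm (star x) = norm (x::'a::cstar_algebra)"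
proof -
  have *: "norm x \<le> norm (star x)" for x :: 'a
    using cstar_identity[of x] norm_mult_ineq[of "star x" x]
    by (cases "x = 0") (auto simp: power2_eq_square mult_le_cancel_right_pos)
  show ?thesis using *[of x] *[of "star x"] by (simp add: star_star)
qed

lemma bounded_linear_star: "bounded_linear (star :: 'a::cstar_algebra \<Rightarrow> 'a)"
  by (rule bounded_linear_intro[where K=1]) (auto simp: star_add star_scaleR norm_star)

lemma star_power: "star (x ^ n) = star (x::'a::cstar_algebra) ^ n"
  by (induction n) (auto simp: star_mult power_commutes)

lemma norm_square_selfadjoint:
  "star x = x \<Longrightarrow> norm (x * x) = (norm (x::'a::cstar_algebra))\<^sup>2"
  using cstar_identity[of x] by simp

lemma scaleC_zero_left [simp]: "0 *\<^sub>C x = (0::'a::cstar_algebra)"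
  using scaleC_of_real[of 0 x] by simp

lemma scaleC_one [simp]: "1 *\<^sub>C x = (x::'a::cstar_algebra)"
  using scaleC_of_real[of 1 x] by simp

lemma scaleC_zero_right [simp]: "a *\<^sub>C 0 = (0::'a::cstar_algebra)"
  using scaleC_add_right[of a 0 "0::'a"] by simp

lemma scaleC_minus_right: "a *\<^sub>C (- x) = - (a *\<^sub>C (x::'a::cstar_algebra))"
  using scaleC_add_right[of a x "- x"] by (simp add: add_eq_0_iff)

lemma scaleC_minus_left: "(- a) *\<^sub>C x = - (a *\<^sub>C (x::'a::cstar_algebra))"
  using scaleC_add_left[of a "- a" x] by (simp add: add_eq_0_iff)

lemma scaleC_diff_right: "a *\<^sub>C (x - y) = a *\<^sub>C x - a *\<^sub>C (y::'a::cstar_algebra)"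
  using scaleC_add_right[of a x "- y"] by (simp add: scaleC_minus_right)

lemma scaleC_diff_left: "(a - b) *\<^sub>C x = a *\<^sub>C x - b *\<^sub>C (x::'a::cstar_algebra)"
  using scaleC_add_left[of a "- b" x] by (simp add: scaleC_minus_left)

section \<open>Square roots by the binomial series\<close>

text \<open>
  The Taylor coefficients of $\sqrt{1-x}$. All but the zeroth are nonpositive and their absolute values
  sum to at most $1$, which makes the series usable on the whole closed unit ball of a Banach algebra.
\<close>

definition sqrt_coeff :: "nat \<Rightarrow> real" where
  "sqrt_coeff n = (-1) ^ n * ((1/2) gchoose n)"

lemma sqrt_coeff_Suc_nonpos: "sqrt_coeff (Suc n) \<le> 0"
proof -
  have "sqrt_coeff (Suc n) = pochhammer (- (1/2)) (Suc n) / fact (Suc n)"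
    unfolding sqrt_coeff_def gbinomial_pochhammer
    by (simp only: mult.assoc[symmetric] times_divide_eq_right power_add[symmetric])
       (simp flip: mult_2)
  moreover have "pochhammer (1/2 :: real) n \<ge> 0" by (rule pochhammer_nonneg) simp
  ultimately show ?thesis by (simp add: pochhammer_rec divide_nonpos_pos)
qed

text \<open>
  Partial sums of $\sum_k (-1)^k {a \choose k}$ telescope to $(-1)^N {a-1 \choose N}$; for $a = 1/2$ this is
  nonnegative, and by the signs of the coefficients it equals $1$ minus the sum of absolute values.
\<close>

lemma sum_abs_sqrt_coeff_le_1: "(\<Sum>n<N. \<bar>sqrt_coeff (Suc n)\<bar>) \<le> 1"
proof -
  have "(\<Sum>n\<le>N. sqrt_coeff n) = (-1) ^ N * ((- (1/2)) gchoose N)"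
    using gbinomial_sum_lower_neg[of "1/2::real" N]
    by (simp add: sqrt_coeff_def mult.commute)
  also have "\<dots> = pochhammer (1/2) N / fact N"
    unfolding gbinomial_pochhammer
    by (simp only: mult.assoc[symmetric] times_divide_eq_right power_add[symmetric])
       (simp flip: mult_2)
  also have "\<dots> \<ge> 0" by (simp add: pochhammer_nonneg)
  finally have "0 \<le> (\<Sum>n\<le>N. sqrt_coeff n)" .
  also have "\<dots> = 1 + (\<Sum>n<N. sqrt_coeff (Suc n))"
    by (simp add: sum.atMost_shift sqrt_coeff_def)
  also have "\<dots> = 1 - (\<Sum>n<N. \<bar>sqrt_coeff (Suc n)\<bar>)"
    using sqrt_coeff_Suc_nonpos by (simp add: abs_of_nonpos sum_negf)
  finally show ?thesis by simp
qed

text \<open>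
  Vandermonde's identity in the form $\sqrt{1-x}\cdot\sqrt{1-x} = 1 - x$ for formal power series.
\<close>

lemma sqrt_coeff_convolution:
  "(\<Sum>i\<le>n. sqrt_coeff i * sqrt_coeff (n - i)) = (if n = 0 then 1 else if n = 1 then - 1 else 0)"
proof -
  have "(\<Sum>i\<le>n. sqrt_coeff i * sqrt_coeff (n - i))
      = (\<Sum>i\<le>n. (-1) ^ n * (((1/2) gchoose i) * ((1/2) gchoose (n - i))))"
  proof (intro sum.cong refl)
    fix i assume "i \<in> {..n}"
    then have "(-1::real) ^ n = (-1) ^ i * (-1) ^ (n - i)" by (simp flip: power_add)
    then show "sqrt_coeff i * sqrt_coeff (n - i) = (-1) ^ n * (((1/2) gchoose i) * ((1/2) gchoose (n - i)))"
      by (simp add: sqrt_coeff_def)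
  qed
  also have "\<dots> = (-1) ^ n * (1 gchoose n)"
    using gbinomial_Vandermonde[of "1/2::real" "1/2" n]
    by (simp flip: sum_distrib_left add: atMost_atLeast0)
  also have "(1 gchoose n) = (of_nat (1 choose n) :: real)"
    by (simp add: binomial_gbinomial)
  finally show ?thesis by (cases n) auto
qed

text \<open>
  The bound on $1 - y$ says that the root is again positive in the sense introduced below, and the last
  clause, which holds because $y$ is a limit of polynomials in $a$, stands in for functional calculus.
\<close>

lemma sqrt_one_minus:
  fixes a :: "'a::cstar_algebra"
  assumes "star a = a" "norm a \<le> 1"
  obtains y where "star y = y" "y * y = 1 - a" "norm (1 - y) \<le> 1"
    "\<And>x. x * a = a * x \<Longrightarrow> x * y = y * x"
proof -
  let ?f = "\<lambda>n. sqrt_coeff n *\<^sub>R a ^ n"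
  define y where "y = (\<Sum>n. ?f n)"
  have abs: "summable (\<lambda>n. \<bar>sqrt_coeff (Suc n)\<bar>)"
    by (rule summableI_nonneg_bounded[where x=1]) (auto simp: sum_abs_sqrt_coeff_le_1)
  then have abs': "summable (\<lambda>n. \<bar>sqrt_coeff n\<bar>)" by (subst (asm) summable_Suc_iff)
  have nle: "norm (?f n) \<le> \<bar>sqrt_coeff n\<bar>" for n
    using assms(2) norm_power_ineq[of a n] power_le_one[of "norm a" n]
    by (auto intro!: mult_left_le)
  have ns: "summable (\<lambda>n. norm (?f n))"
    by (rule summable_comparison_test'[OF abs', of 0]) (simp add: nle del: norm_scaleR)
  then have s: "summable ?f" by (rule summable_norm_cancel)
  then have fy: "?f sums y" unfolding y_def by (rule summable_sums)
  have "(\<lambda>n. star (?f n)) sums star y"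
    by (rule bounded_linear.sums[OF bounded_linear_star fy])
  then have "?f sums star y" by (simp add: star_scaleR star_power assms)
  then have 1: "star y = y" using fy sums_unique2 by blast
  have "(\<lambda>k. \<Sum>i\<le>k. ?f i * ?f (k - i)) sums (y * y)"
    unfolding y_def by (rule Cauchy_product_sums[OF ns ns])
  moreover have "(\<Sum>i\<le>k. ?f i * ?f (k - i)) = (if k = 0 then 1 else if k = 1 then - a else 0)" for k
  proof -
    have "(\<Sum>i\<le>k. ?f i * ?f (k - i)) = (\<Sum>i\<le>k. (sqrt_coeff i * sqrt_coeff (k - i)) *\<^sub>R a ^ k)"
      by (intro sum.cong) (auto simp flip: power_add)
    also have "\<dots> = (\<Sum>i\<le>k. sqrt_coeff i * sqrt_coeff (k - i)) *\<^sub>R a ^ k"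
      by (rule scaleR_sum_left[symmetric])
    finally show ?thesis unfolding sqrt_coeff_convolution by auto
  qed
  moreover have "(\<lambda>k. if k = 0 then 1 else if k = 1 then - a else 0) sums (1 - a)"
    using sums_finite[of "{0,1::nat}" "\<lambda>k. if k = 0 then 1 else if k = 1 then - a else 0"] by simp
  ultimately have 2: "y * y = 1 - a" using sums_unique2 by simp
  have "(\<lambda>n. ?f (Suc n)) sums (y - 1)"
    using fy by (subst sums_Suc_iff) (simp add: sqrt_coeff_def)
  then have "y - 1 = (\<Sum>n. ?f (Suc n))" by (rule sums_unique)
  also have "norm \<dots> \<le> (\<Sum>n. \<bar>sqrt_coeff (Suc n)\<bar>)"
    by (rule norm_suminf_le[OF nle abs])
  also have "\<dots> \<le> 1" by (rule suminf_le_const[OF abs]) (rule sum_abs_sqrt_coeff_le_1)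
  finally have 3: "norm (1 - y) \<le> 1" by (simp add: norm_minus_commute)
  have 4: "x * y = y * x" if "x * a = a * x" for x
  proof -
    have "x * a ^ n = a ^ n * x" for n
      by (induction n) (auto simp: that mult.assoc, metis mult.assoc that)
    then have "(\<lambda>n. x * ?f n) = (\<lambda>n. ?f n * x)" by (simp add: fun_eq_iff)
    then show ?thesis
      using sums_mult[OF fy, of x] sums_mult2[OF fy, of x] sums_unique2 by metis
  qed
  show ?thesis by (rule that[OF 1 2 3 4])
qed

section \<open>The positive cone\<close>

text \<open>
  Positivity without spectra: for self-adjoint $a$, the distance from $t$ to $a$ is at most $t$ exactly
  when the spectrum of $a$ lies in $[0,2t]$. In this form, closure under addition is just the triangle
  inequality; that squares are positive takes some work.
\<close>

definition positive :: "'a::cstar_algebra \<Rightarrow> bool" where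
  "positive a \<longleftrightarrow> star a = a \<and> (\<exists>t\<ge>0. norm (of_real t - a) \<le> t)"

lemma positive_selfadjoint: "positive a \<Longrightarrow> star a = a"
  by (simp add: positive_def)

lemma positive_add:
  assumes "positive a" "positive b"
  shows "positive (a + b)"
proof -
  obtain s t where "s \<ge> 0" "norm (of_real s - a) \<le> s" "t \<ge> 0" "norm (of_real t - b) \<le> t"
    using assms by (auto simp: positive_def)
  then have "s + t \<ge> 0" "norm (of_real (s + t) - (a + b)) \<le> s + t"
    using norm_triangle_ineq[of "of_real s - a" "of_real t - b"] by (auto simp: algebra_simps)
  then show ?thesis using assms by (auto simp: positive_def star_add)
qed

lemma positive_scaleR:
  assumes "positive a" "0 \<le> r"
  shows "positive (r *\<^sub>R a)"
proof -
  obtain t where t: "t \<ge> 0" "norm (of_real t - a) \<le> t"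
    using assms by (auto simp: positive_def)
  have "of_real (r * t) - r *\<^sub>R a = r *\<^sub>R (of_real t - a)"
    by (simp add: of_real_def scaleR_diff_right)
  then have "norm (of_real (r * t) - r *\<^sub>R a) = r * norm (of_real t - a)"
    using assms by simp
  also have "\<dots> \<le> r * t" using t assms by (intro mult_left_mono)
  finally show ?thesis using assms t
    by (auto simp: positive_def star_scaleR intro!: exI[of _ "r * t"])
qed

lemma positive_of_real: "0 \<le> r \<Longrightarrow> positive (of_real r)"
  by (auto simp: positive_def intro!: exI[of _ r])

lemma positive_norm_minus: "star a = a \<Longrightarrow> positive (of_real (norm a) - a)"
  by (auto simp: positive_def star_diff intro!: exI[of _ "norm a"])

lemma positive_norm_plus: "star a = a \<Longrightarrow> positive (of_real (norm a) + a)"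
  using positive_norm_minus[of "- a"] by (simp add: star_minus)

text \<open>
  With $a = t(1 - b)$ and $b$ in the unit ball, the root is $\sqrt t$ times the root of $1 - b$.
\<close>

lemma positive_sqrt:
  fixes a :: "'a::cstar_algebra"
  assumes "positive a"
  obtains y where "positive y" "y * y = a" "\<And>x. x * a = a * x \<Longrightarrow> x * y = y * x"
proof -
  obtain s where s: "s \<ge> 0" "norm (of_real s - a) \<le> s" "star a = a"
    using assms by (auto simp: positive_def)
  \<comment> \<open>The radius is enlarged so that it is nonzero and can be divided by.\<close>
  define t where "t = s + 1"
  have "of_real t - a = (of_real s - a) + 1" by (simp add: t_def)
  then have t: "t > 0" "norm (of_real t - a) \<le> t"
    using s norm_triangle_ineq[of "of_real s - a" 1] by (auto simp: t_def algebra_simps)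
  define b where "b = (1 / t) *\<^sub>R (of_real t - a)"
  have b: "star b = b" "norm b \<le> 1"
    using t s by (auto simp: b_def star_scaleR star_diff divide_simps)
  have tb: "t *\<^sub>R (1 - b) = a"
    using t by (simp add: b_def of_real_def scaleR_diff_right)
  obtain z where z: "star z = z" "z * z = 1 - b" "norm (1 - z) \<le> 1"
    "\<And>x. x * b = b * x \<Longrightarrow> x * z = z * x" by (rule sqrt_one_minus[OF b]) blast
  have "positive z" using z(1,3) by (auto simp: positive_def intro!: exI[of _ 1])
  then have 1: "positive (sqrt t *\<^sub>R z)" using t by (intro positive_scaleR) auto
  have 2: "sqrt t *\<^sub>R z * sqrt t *\<^sub>R z = a" using t z(2) tb by simp
  have 3: "x * sqrt t *\<^sub>R z = sqrt t *\<^sub>R z * x" if "x * a = a * x" for x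
  proof -
    have "x * b = b * x" using that
      by (simp add: b_def algebra_simps of_real_def)
    from z(4)[OF this] show ?thesis by simp
  qed
  show ?thesis by (rule that[OF 1 2 3])
qed

text \<open>
  The element $u = x + iy$ satisfies $u^*u = x^2 + y^2 = b$, so its norm is $\sqrt{|b|}$, and $x$ is its real part.
  This stands in for the functional calculus of a commuting pair.
\<close>

lemma norm_le_of_commuting_squares:
  fixes x y :: "'a::cstar_algebra"
  assumes "star x = x" "star y = y" "x * y = y * x" "x * x + y * y = of_real b"
  shows "(norm x)\<^sup>2 \<le> \<bar>b\<bar>"
proof -
  define u where "u = x + \<i> *\<^sub>C y"
  have su: "star u = x - \<i> *\<^sub>C y"
    by (simp add: u_def star_add star_scaleC assms scaleC_minus_left)
  have "star u * u = x * x + y * y"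
    unfolding su unfolding u_def
    by (simp add: algebra_simps mult_scaleC_left mult_scaleC_right scaleC_scaleC assms(3) scaleC_minus_left scaleC_diff_right scaleC_add_right)
  then have nu: "(norm u)\<^sup>2 = \<bar>b\<bar>" using cstar_identity[of u] assms(4) by simp
  have "u + star u = 2 *\<^sub>R x" unfolding su by (simp add: u_def scaleR_2)
  then have "2 * norm x = norm (u + star u)" by simp
  also have "\<dots> \<le> 2 * norm u" using norm_triangle_ineq[of u "star u"] by (simp add: norm_star)
  finally have "norm x \<le> norm u" by simp
  then show ?thesis using nu power_mono[of "norm x" "norm u" 2] by simp
qed

text \<open>
  Apply the previous lemma to square roots of $a$ and $b - a$.
\<close>

lemma norm_le_of_positive:
  fixes a :: "'a::cstar_algebra"
  assumes "positive a" "positive (of_real b - a)"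
  shows "norm a \<le> \<bar>b\<bar>"
proof -
  obtain x where x: "positive x" "x * x = a" using positive_sqrt[OF assms(1)] by metis
  obtain y where y: "positive y" "y * y = of_real b - a"
    "\<And>z. z * (of_real b - a) = (of_real b - a) * z \<Longrightarrow> z * y = y * z"
    using positive_sqrt[OF assms(2)] by metis
  have "x * a = a * x" using x(2) by (metis mult.assoc)
  then have "x * y = y * x" by (intro y(3)) (simp add: algebra_simps of_real_def)
  then have "(norm x)\<^sup>2 \<le> \<bar>b\<bar>"
    using x y(1,2) by (intro norm_le_of_commuting_squares[of x y]) (auto simp: positive_selfadjoint)
  then show ?thesis
    using norm_square_selfadjoint[of x] x by (simp add: positive_selfadjoint)
qed

lemma positive_antisym: "positive a \<Longrightarrow> positive (- a) \<Longrightarrow> a = 0"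
  using norm_le_of_positive[of a 0] by simp

lemma positive_of_real_iff: "positive (of_real r :: 'a::cstar_algebra) \<longleftrightarrow> 0 \<le> r"
proof
  assume *: "positive (of_real r :: 'a)"
  show "0 \<le> r"
  proof (rule ccontr)
    assume "\<not> 0 \<le> r"
    then have "positive (- of_real r :: 'a)" using positive_of_real[of "- r"] by simp
    with * have "(of_real r :: 'a) = 0" by (rule positive_antisym)
    with \<open>\<not> 0 \<le> r\<close> show False by simp
  qed
qed (rule positive_of_real)

lemma norm_mono_positive:
  fixes a b :: "'a::cstar_algebra"
  assumes "positive a" "positive (b - a)"
  shows "norm a \<le> norm b"
proof -
  have "star b = b"
    using assms star_add[of a "b - a"] by (simp add: positive_selfadjoint)
  then have "positive ((of_real (norm b) - b) + (b - a))"
    using assms by (intro positive_add positive_norm_minus)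
  then show ?thesis using norm_le_of_positive[OF assms(1), of "norm b"] by simp
qed

text \<open>
  With $r = \|x\|^2$, the element $r - x^2$ is positive by definition; its root $y$ commutes with $x$ and
  $x^2 + y^2 = r$, so $\|r - x^2\| = \|y\|^2 \le r$.
\<close>

lemma positive_square:
  fixes x :: "'a::cstar_algebra"
  assumes "star x = x"
  shows "positive (x * x)"
proof -
  define r where "r = (norm x)\<^sup>2"
  have n: "norm (x * x) = r" "star (x * x) = x * x"
    using assms norm_square_selfadjoint by (auto simp: r_def star_mult)
  then have "positive (of_real r - x * x)" using positive_norm_minus[of "x * x"] by simp
  then obtain y where y: "positive y" "y * y = of_real r - x * x"
    "\<And>z. z * (of_real r - x * x) = (of_real r - x * x) * z \<Longrightarrow> z * y = y * z"
    using positive_sqrt by metis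
  have "x * y = y * x" by (intro y(3)) (simp add: algebra_simps of_real_def)
  then have "(norm y)\<^sup>2 \<le> \<bar>r\<bar>"
    using y(1,2) assms by (intro norm_le_of_commuting_squares[of y x]) (auto simp: positive_selfadjoint)
  then have "norm (of_real r - x * x) \<le> r"
    using norm_square_selfadjoint[of y] y(1,2) by (simp add: positive_selfadjoint r_def)
  then show ?thesis
    unfolding positive_def using n(2) by (intro conjI exI[of _ r]) (simp_all add: r_def)
qed

lemma positive_mult:
  fixes a b :: "'a::cstar_algebra"
  assumes "positive a" "positive b" "a * b = b * a"
  shows "positive (a * b)"
proof -
  obtain x where x: "positive x" "x * x = a" "\<And>z. z * a = a * z \<Longrightarrow> z * x = x * z"
    using positive_sqrt[OF assms(1)] by metis
  obtain y where y: "positive y" "y * y = b" "\<And>z. z * b = b * z \<Longrightarrow> z * y = y * z"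
    using positive_sqrt[OF assms(2)] by metis
  have "b * x = x * b" using x(3)[OF assms(3)[symmetric]] .
  then have c: "x * y = y * x" by (intro y(3)) simp
  then have "star (x * y) = x * y" using x(1) y(1) by (simp add: star_mult positive_selfadjoint)
  then have "positive (x * y * (x * y))" by (rule positive_square)
  also have "x * y * (x * y) = a * b" using c x(2) y(2) by (metis mult.assoc)
  finally show ?thesis .
qed

lemma norm_add_of_real_positive:
  fixes p :: "'a::cstar_algebra"
  assumes "positive p" "0 \<le> r"
  shows "norm (p + of_real r) = norm p + r"
proof (rule antisym)
  show "norm (p + of_real r) \<le> norm p + r"
    using norm_triangle_ineq[of p "of_real r"] assms by simp
  define s where "s = norm (p + of_real r)"
  have "star (p + of_real r) = p + of_real r" using assms by (simp add: positive_selfadjoint star_add)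
  then have "positive (of_real s - (p + of_real r))" unfolding s_def by (rule positive_norm_minus)
  then have *: "positive (of_real (s - r) - p)" by (simp add: algebra_simps)
  then have "positive ((of_real (s - r) - p) + p)" using assms positive_add by blast
  then have "0 \<le> s - r" using positive_of_real_iff[of "s - r", where 'a='a] by simp
  then show "norm p + r \<le> norm (p + of_real r)"
    using norm_le_of_positive[OF assms(1) *] by (simp add: s_def)
qed

text \<open>
  The classical argument compares the spectra of $y^*y$ and $yy^*$; this is a norm version of it. Put
  $p = yy^*$ and $q = -y^*y$. Since $p - q = yy^* + y^*y$ is twice a sum of two squares, $p$ is positive along
  with $q$. From $(1+p)y = y(1-q)$ and $\|1-q\| \le 1$, multiplication by $1+p$ does not enlarge $y$. But
  $\|(1+p)y\|^2 = \|(1+p)p(1+p)\| \ge \|p + 2p^2\|$, which exceeds $\|p\| = \|y\|^2$ unless $p = 0$.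
\<close>

lemma eq_0_if_star_mult_negative:
  fixes y :: "'a::cstar_algebra"
  assumes "positive (- (star y * y))"
  shows "y = 0"
proof -
  \<comment> \<open>Scaling to the unit ball makes the norm of q at most 1, hence also that of 1 - q.\<close>
  define k where "k = (if y = 0 then 1 else norm y)"
  define z where "z = (1 / k) *\<^sub>R y"
  have k: "k > 0" by (simp add: k_def)
  define p where "p = z * star z"
  define q where "q = - (star z * z)"
  have sq: "star z * z = (1 / k)\<^sup>2 *\<^sub>R (star y * y)"
    by (simp add: z_def star_scaleR power2_eq_square)
  have q: "positive q"
    using positive_scaleR[OF assms, of "(1 / k)\<^sup>2"] by (simp add: q_def sq)
  have nz: "norm z \<le> 1" by (simp add: z_def k_def)
  have nq: "norm q \<le> 1"
    using nz by (simp add: q_def cstar_identity power_le_one)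
  \<comment> \<open>The real and (up to sign) imaginary parts of z.\<close>
  define a b where "a = (1/2) *\<^sub>R (z + star z)" and "b = (\<i> / 2) *\<^sub>C (z - star z)"
  have a: "star a = a" by (simp add: a_def star_scaleR star_add star_star add.commute)
  have b: "star b = b"
    by (simp add: b_def star_scaleC star_diff star_star scaleC_minus_left scaleC_diff_right)
  have aa: "a * a = (1/4) *\<^sub>R (z * z + z * star z + star z * z + star z * star z)"
    by (simp add: a_def algebra_simps)
  have mi: "(\<i> / 2 * (\<i> / 2)) = complex_of_real (- (1/4))" by (simp add: complex_eq_iff)
  have "b * b = (\<i> / 2 * (\<i> / 2)) *\<^sub>C ((z - star z) * (z - star z))"
    by (simp add: b_def mult_scaleC_left mult_scaleC_right scaleC_scaleC)
  also have "\<dots> = (- (1/4)) *\<^sub>R ((z - star z) * (z - star z))"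
    unfolding mi scaleC_of_real ..
  finally have bb: "b * b = (1/4) *\<^sub>R (z * star z + star z * z - z * z - star z * star z)"
    by (simp add: algebra_simps)
  have "2 *\<^sub>R (a * a + b * b) = z * star z + star z * z"
    unfolding aa bb by (simp add: algebra_simps flip: scaleR_add_left)
  then have "p = 2 *\<^sub>R (a * a + b * b) + q" by (simp add: p_def q_def)
  moreover have "positive (2 *\<^sub>R (a * a + b * b) + q)"
    using a b q by (intro positive_add positive_scaleR positive_square) auto
  ultimately have p: "positive p" by simp
  have pp: "positive (p * p)" "positive (p * (p * p))" "positive (p * p + p * (p * p))"
    using p by (auto intro!: positive_mult positive_add simp: mult.assoc)
  have "positive (1 - q)"
    using positive_add[OF positive_norm_minus[of q] positive_of_real[of "1 - norm q"]] q nq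
    by (simp add: positive_selfadjoint)
  then have n1: "norm (1 - q) \<le> 1" using norm_le_of_positive[of "1 - q" 1] q by simp
  define w where "w = z * (1 - q)"
  have w: "w = (1 + p) * z" by (simp add: w_def p_def q_def algebra_simps)
  have "norm w \<le> norm z"
    unfolding w_def using norm_mult_ineq[of z "1 - q"] n1
    by (meson mult_left_le norm_ge_zero order_trans)
  then have "norm (w * star w) \<le> norm p"
    using cstar_identity[of "star w"] cstar_identity[of "star z"]
    by (simp add: star_star norm_star p_def power_mono)
  also have "w * star w = p + 2 *\<^sub>R (p * p) + p * (p * p)"
    using p by (simp add: w star_mult star_add positive_selfadjoint algebra_simps scaleR_2)
       (simp add: p_def algebra_simps)
  finally have "norm (p + 2 *\<^sub>R (p * p) + p * (p * p)) \<le> norm p" .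
  moreover have "norm (p + 2 *\<^sub>R (p * p)) \<le> norm (p + 2 *\<^sub>R (p * p) + p * (p * p))"
    using p pp by (intro norm_mono_positive positive_add positive_scaleR) auto
  ultimately have "norm (p + 2 *\<^sub>R (p * p)) \<le> norm p" by simp
  \<comment> \<open>Completing the square turns the bound on \<open>p + 2 p * p\<close> into one on the norm of p itself.\<close>
  moreover have "(p + of_real (1/4)) * (p + of_real (1/4))
      = (1/2) *\<^sub>R (p + 2 *\<^sub>R (p * p)) + of_real (1/16)"
    by (simp add: of_real_def algebra_simps flip: scaleR_add_left)
  ultimately have "(norm (p + of_real (1/4)))\<^sup>2 \<le> norm p / 2 + 1/16"
    using norm_triangle_ineq[of "(1/2) *\<^sub>R (p + 2 *\<^sub>R (p * p))" "of_real (1/16)"]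
      norm_square_selfadjoint[of "p + of_real (1/4)"] p
    by (simp add: star_add positive_selfadjoint)
  then have "(norm p + 1/4)\<^sup>2 \<le> norm p / 2 + 1/16"
    using norm_add_of_real_positive[OF p, of "1/4"] by simp
  then have "p = 0" by (simp add: power2_eq_square algebra_simps mult_le_0_iff)
  then have "z = 0"
    using cstar_identity[of "star z"] by (simp add: p_def star_star norm_star)
  then show "y = 0" using k by (simp add: z_def)
qed

text \<open>
  Let $a = x^*x$ and let $m = |a|$ be the root of $a^2$. Then $c = m - a$ is twice the negative part of $a$, and
  $ac = -c^2/2$. Hence $(xc)^*(xc) = cac = -c^3/2$, where $c^3 = 2mc^2$ is positive; so $xc = 0$ by the previous
  lemma. This gives $c^2 = -2ac = 0$, and $a = m$ is positive.
\<close>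

theorem positive_star_mult:
  fixes x :: "'a::cstar_algebra"
  shows "positive (star x * x)"
proof -
  define a where "a = star x * x"
  have a: "star a = a" by (simp add: a_def star_mult star_star)
  obtain m where m: "positive m" "m * m = a * a" "\<And>z. z * (a * a) = a * a * z \<Longrightarrow> z * m = m * z"
    using positive_sqrt[OF positive_square[OF a]] by metis
  have am: "a * m = m * a" by (rule m(3)) (simp add: mult.assoc)
  define c where "c = m - a"
  have c: "star c = c" using m(1) a by (simp add: c_def star_diff positive_selfadjoint)
  have ca: "c * a = a * c" and cm: "c * m = m * c" by (simp_all add: c_def algebra_simps am)
  have cc: "c * c = 2 *\<^sub>R (m * c)" "a * c = (- (1/2)) *\<^sub>R (c * c)"
    by (simp_all add: c_def algebra_simps am m(2) scaleR_2 flip: scaleR_add_left)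
  have "star (x * c) * (x * c) = c * (a * c)" by (simp add: star_mult c a_def mult.assoc)
  also have "\<dots> = (- (1/2)) *\<^sub>R (c * (c * c))" by (simp add: cc(2))
  finally have e: "- (star (x * c) * (x * c)) = (1/2) *\<^sub>R (c * (c * c))" by simp
  have "c * (c * c) = 2 *\<^sub>R (m * (c * c))"
    by (subst cc(1)) (metis cm mult.assoc mult_scaleR_right)
  moreover have "positive (2 *\<^sub>R (m * (c * c)))"
  proof (intro positive_scaleR positive_mult[OF m(1) positive_square[OF c]])
    show "m * (c * c) = c * c * m" by (metis cm mult.assoc)
  qed simp
  ultimately have "positive (- (star (x * c) * (x * c)))"
    unfolding e by (intro positive_scaleR) auto
  then have "x * c = 0" by (rule eq_0_if_star_mult_negative)
  then have "a * c = 0" by (simp add: a_def mult.assoc)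
  then have "c * c = 0" using cc(2) by simp
  then have "c = 0" using norm_square_selfadjoint[OF c] by simp
  then show ?thesis using m(1) by (simp add: c_def a_def)
qed

section \<open>The spectrum of a self-adjoint element\<close>

lemma geometric_inverse:
  fixes x :: "'a::{banach,real_normed_algebra_1}"
  assumes "norm x < 1"
  obtains y where "y * (1 - x) = 1" "(1 - x) * y = 1"
proof -
  have "summable (\<lambda>n. x ^ n)"
    by (rule summable_comparison_test'[of "\<lambda>n. norm x ^ n" 0])
       (use assms in \<open>auto simp: norm_power_ineq intro: summable_geometric\<close>)
  then have y: "(\<lambda>n. x ^ n) sums (\<Sum>n. x ^ n)" by (rule summable_sums)
  have "(\<lambda>n. x ^ n) \<longlonglongrightarrow> 0"
    using \<open>summable (\<lambda>n. x ^ n)\<close> by (rule summable_LIMSEQ_zero)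
  then have "(\<lambda>n. x ^ n - x ^ Suc n) sums 1" using telescope_sums'[of "\<lambda>n. x ^ n" 0] by simp
  then have "(\<lambda>n. x ^ n * (1 - x)) sums 1" "(\<lambda>n. (1 - x) * x ^ n) sums 1"
    by (simp_all add: algebra_simps power_commutes)
  then show ?thesis
    using sums_mult[OF y, of "1 - x"] sums_mult2[OF y, of "1 - x"] sums_unique2 that by metis
qed

definition invertible_element :: "'a::ring_1 \<Rightarrow> bool" where
  "invertible_element a \<longleftrightarrow> (\<exists>b. b * a = 1 \<and> a * b = 1)"

lemma spectrum_iff: "z \<in> spectrum a \<longleftrightarrow> \<not> invertible_element (z *\<^sub>C 1 - a)"
  by (simp add: spectrum_def invertible_element_def)

lemma scaleC_of_real_1: "complex_of_real r *\<^sub>C 1 = (of_real r :: 'a::cstar_algebra)"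
  by (simp add: scaleC_of_real scaleR_conv_of_real)

lemma of_real_spectrum_iff:
  "complex_of_real t \<in> spectrum a \<longleftrightarrow> \<not> invertible_element (of_real t - a)"
  by (simp add: spectrum_iff scaleC_of_real_1)

text \<open>
  If $b \ge e > 0$ then $b$ is closer to $m = \|b\| + e$ than $m$ itself, so $b/m$ has a Neumann inverse.
\<close>

lemma invertible_if_bounded_below:
  fixes b :: "'a::cstar_algebra"
  assumes "positive (b - of_real e)" "e > 0"
  shows "invertible_element b"
proof -
  have b: "star b = b" using positive_selfadjoint[OF assms(1)] by (simp add: star_diff)
  define m where "m = norm b + e"
  have m: "m > 0" using assms by (simp add: m_def add_nonneg_pos)
  define x where "x = (1 / m) *\<^sub>R (of_real m - b)"
  have "positive (of_real m - b)"
    using positive_add[OF positive_norm_minus[OF b] positive_of_real[of e]] assms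
    by (simp add: m_def algebra_simps)
  moreover have "positive (of_real (norm b) - (of_real m - b))"
    using assms by (simp add: m_def algebra_simps)
  ultimately have "norm (of_real m - b) \<le> norm b"
    using norm_le_of_positive by fastforce
  then have "norm x < 1" using m assms(2) by (simp add: x_def m_def)
  then obtain y where y: "y * (1 - x) = 1" "(1 - x) * y = 1" by (rule geometric_inverse)
  have "1 - x = (1 / m) *\<^sub>R b" using m by (simp add: x_def of_real_def scaleR_diff_right)
  then have "((1 / m) *\<^sub>R y) * b = 1" "b * ((1 / m) *\<^sub>R y) = 1" using y by simp_all
  then show ?thesis unfolding invertible_element_def by blast
qed

lemma invertible_factor:
  fixes a b :: "'a::ring_1"
  assumes "invertible_element (a * b)" "a * b = b * a"
  shows "invertible_element a"
proof -
  obtain c where "c * (a * b) = 1" "(a * b) * c = 1"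
    using assms unfolding invertible_element_def by blast
  then have l: "(c * b) * a = 1" and r: "a * (b * c) = 1"
    by (metis assms(2) mult.assoc)+
  have "c * b = c * b * (a * (b * c))" by (simp add: r)
  also have "\<dots> = b * c" by (metis l mult.assoc mult_1)
  finally show ?thesis using l r unfolding invertible_element_def by metis
qed

text \<open>
  For $z = \alpha + i\beta$ the product of $z - h$ and $\bar z - h$ is $(\alpha - h)^2 + \beta^2$, which is bounded below
  when $\beta \ne 0$.
\<close>

lemma spectrum_selfadjoint_real:
  fixes h :: "'a::cstar_algebra"
  assumes "star h = h" "z \<in> spectrum h"
  shows "z \<in> \<real>"
proof (rule ccontr)
  assume "z \<notin> \<real>"
  then have z: "Im z \<noteq> 0" by (simp add: complex_is_Real_iff)
  define k where "k = of_real (Re z) - h"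
  define a where "a = z *\<^sub>C 1 - h"
  define b where "b = cnj z *\<^sub>C 1 - h"
  have ri: "w *\<^sub>C 1 = of_real (Re w) + of_real (Im w) * \<i> *\<^sub>C (1::'a)" for w
  proof -
    have "w *\<^sub>C (1::'a) = (complex_of_real (Re w) + complex_of_real (Im w) * \<i>) *\<^sub>C 1"
      using complex_eq[of w] by (simp add: mult.commute)
    then show ?thesis by (simp add: scaleC_add_left scaleC_of_real_1 flip: scaleC_scaleC)
        (simp add: scaleC_of_real scaleR_conv_of_real)
  qed
  have a: "a = k + Im z *\<^sub>R (\<i> *\<^sub>C 1)" and b: "b = k - Im z *\<^sub>R (\<i> *\<^sub>C 1)"
    by (simp_all add: a_def b_def k_def ri[of z] ri[of "cnj z"] of_real_def)
  have ab: "a * b = k * k + of_real ((Im z)\<^sup>2)" "b * a = k * k + of_real ((Im z)\<^sup>2)"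
  proof -
    define j :: 'a where "j = \<i> *\<^sub>C 1"
    have "j * j = - 1" "j * k = k * j"
      by (simp_all add: j_def mult_scaleC_left mult_scaleC_right scaleC_scaleC scaleC_minus_left)
    then show "a * b = k * k + of_real ((Im z)\<^sup>2)" "b * a = k * k + of_real ((Im z)\<^sup>2)"
      unfolding a b by (simp_all add: algebra_simps power2_eq_square of_real_def flip: j_def)
  qed
  have "star k = k" using assms by (simp add: k_def star_diff)
  then have "positive (a * b - of_real ((Im z)\<^sup>2))"
    unfolding ab by (simp add: positive_square)
  then have "invertible_element (a * b)"
    by (rule invertible_if_bounded_below) (use z in simp)
  then have "invertible_element a" by (rule invertible_factor) (simp add: ab)
  then show False using assms by (simp add: spectrum_iff a_def)
qed

text \<open>
  For positive $a$ the norm condition already holds with $t = \|a\|$, and that form of it passes to limits.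
\<close>

lemma positive_closed:
  fixes a :: "'a::cstar_algebra"
  assumes "\<And>e. e > 0 \<Longrightarrow> positive (a + of_real e)"
  shows "positive a"
proof -
  have a: "star a = a" using positive_selfadjoint[OF assms[of 1]] by (simp add: star_add)
  have "norm (of_real (norm a) - a) \<le> norm a + e" if "e > 0" for e
    using norm_le_of_positive[OF positive_norm_minus[OF a], of "norm a + e"] assms[OF that] that
    by (simp add: algebra_simps)
  then have "norm (of_real (norm a) - a) \<le> norm a" by (rule field_le_epsilon)
  then show ?thesis using a norm_ge_zero unfolding positive_def by blast
qed

text \<open>
  The inverse $g = gbg$ is positive, and $(\|g\| - g)\,b \ge 0$ reads $\|g\|\, b \ge 1$.
\<close>

lemma bounded_below_if_invertible:
  fixes b :: "'a::cstar_algebra"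
  assumes "positive b" "invertible_element b"
  obtains e where "e > 0" "positive (b - of_real e)"
proof -
  obtain g where g: "g * b = 1" "b * g = 1" using assms(2) by (auto simp: invertible_element_def)
  have "star g * b = 1" "b * star g = 1"
    using g positive_selfadjoint[OF assms(1)] star_mult[of b g] star_mult[of g b] by auto
  then have sg: "star g = g" by (metis g(1) mult.assoc mult_1 mult.right_neutral)
  have "positive (g * b * g)"
  proof -
    obtain x where x: "positive x" "x * x = b" using positive_sqrt[OF assms(1)] by metis
    have "g * b * g = star (x * g) * (x * g)"
      using x sg by (simp add: star_mult positive_selfadjoint mult.assoc flip: x(2))
    then show ?thesis by (simp add: positive_star_mult)
  qed
  then have pg: "positive g" using g by simp
  define n where "n = norm g"
  have n: "n > 0" using g by (auto simp: n_def)
  have "positive ((of_real n - g) * b)"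
    using positive_norm_minus[OF sg] assms(1) g
    by (intro positive_mult) (auto simp: algebra_simps n_def of_real_def)
  then have "positive ((1 / n) *\<^sub>R ((of_real n - g) * b))"
    using n by (intro positive_scaleR) auto
  also have "(1 / n) *\<^sub>R ((of_real n - g) * b) = b - of_real (1 / n)"
    using n g by (simp add: algebra_simps of_real_def)
  finally show ?thesis using n that[of "1 / n"] by simp
qed

text \<open>
  For self-adjoint $a$ this is the maximum of the spectrum, and also the maximum of $\varphi(a)$ over all
  states $\varphi$.
\<close>

definition upper_bound :: "'a::cstar_algebra \<Rightarrow> real" where
  "upper_bound a = Inf {t. positive (of_real t - a)}"

lemma upper_bounds_nonempty: "star a = a \<Longrightarrow> {t. positive (of_real t - a)} \<noteq> {}"
  using positive_norm_minus by blast

lemma upper_bounds_bdd_below: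
  fixes a :: "'a::cstar_algebra"
  assumes "star a = a"
  shows "bdd_below {t. positive (of_real t - a)}"
proof (rule bdd_belowI[of _ "- norm a"])
  fix t assume "t \<in> {t. positive (of_real t - a)}"
  then have "positive ((of_real t - a) + (of_real (norm a) + a))"
    using assms by (intro positive_add positive_norm_plus) auto
  then have "positive (of_real (t + norm a) :: 'a)" by simp
  then show "- norm a \<le> t" unfolding positive_of_real_iff by simp
qed

lemma positive_upper_bound_minus:
  fixes a :: "'a::cstar_algebra"
  assumes "star a = a"
  shows "positive (of_real (upper_bound a) - a)"
proof (rule positive_closed)
  fix e :: real assume "e > 0"
  then obtain t where t: "positive (of_real t - a)" "t < upper_bound a + e"
    using cInf_lessD[OF upper_bounds_nonempty[OF assms], of "upper_bound a + e"]
    by (auto simp: upper_bound_def)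
  then have "positive ((of_real t - a) + of_real (upper_bound a + e - t))"
    by (intro positive_add positive_of_real) auto
  then show "positive (of_real (upper_bound a) - a + of_real e)" by (simp add: algebra_simps)
qed

lemma upper_bound_le:
  "star a = a \<Longrightarrow> positive (of_real t - a) \<Longrightarrow> upper_bound a \<le> t"
  unfolding upper_bound_def by (intro cInf_lower upper_bounds_bdd_below) auto

text \<open>
  Were $M - h$ invertible, it would be bounded below, and $M$ could be lowered.
\<close>

lemma upper_bound_in_spectrum:
  fixes h :: "'a::cstar_algebra"
  assumes "star h = h"
  shows "complex_of_real (upper_bound h) \<in> spectrum h"
  unfolding of_real_spectrum_iff
proof
  assume "invertible_element (of_real (upper_bound h) - h)"
  then obtain e where "e > 0" "positive (of_real (upper_bound h) - h - of_real e)"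
    using bounded_below_if_invertible positive_upper_bound_minus[OF assms] by blast
  then have "positive (of_real (upper_bound h - e) - h)" by (simp add: algebra_simps)
  then show False using upper_bound_le[OF assms] \<open>e > 0\<close> by fastforce
qed

lemma spectrum_le_upper_bound:
  fixes h :: "'a::cstar_algebra"
  assumes "star h = h" "complex_of_real t \<in> spectrum h"
  shows "t \<le> upper_bound h"
proof (rule ccontr)
  assume "\<not> t \<le> upper_bound h"
  then have "positive (of_real t - h - of_real (t - upper_bound h))" "t - upper_bound h > 0"
    using positive_upper_bound_minus[OF assms(1)] by (auto simp: algebra_simps)
  then have "invertible_element (of_real t - h)" by (rule invertible_if_bounded_below)
  then show False using assms by (simp add: of_real_spectrum_iff)
qed

lemma invertible_element_minus: "invertible_element (- a) \<longleftrightarrow> invertible_element a"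
proof -
  have "invertible_element a \<Longrightarrow> invertible_element (- a)" for a :: 'a
    unfolding invertible_element_def by (metis minus_mult_minus)
  from this[of a] this[of "- a"] show ?thesis by auto
qed

lemma spectrum_minus: "complex_of_real t \<in> spectrum (- h) \<longleftrightarrow> complex_of_real (- t) \<in> spectrum h"
  unfolding of_real_spectrum_iff using invertible_element_minus[of "of_real t + h"] by simp

text \<open>
  Both end points belong to the spectrum, so an interval that contains the spectrum contains everything
  between them.
\<close>

lemma smallest_spectral_interval_iff:
  assumes "star h = h"
  shows "smallest_spectral_interval h s t \<longleftrightarrow> s = - upper_bound (- h) \<and> t = upper_bound h"
proof -
  let ?s = "- upper_bound (- h)" and ?t = "upper_bound h"
  have h': "star (- h) = - h" using assms by (simp add: star_minus)
  have mem: "complex_of_real ?t \<in> spectrum h" "complex_of_real ?s \<in> spectrum h"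
    using upper_bound_in_spectrum[OF assms] upper_bound_in_spectrum[OF h'] by (auto simp: spectrum_minus)
  have range: "u \<in> {?s..?t}" if "complex_of_real u \<in> spectrum h" for u
    using spectrum_le_upper_bound[OF assms that] spectrum_le_upper_bound[OF h', of "- u"] that
    unfolding spectrum_minus by auto
  have sub: "spectrum h \<subseteq> complex_of_real ` {?s..?t}"
  proof
    fix z assume z: "z \<in> spectrum h"
    then obtain u where "z = complex_of_real u"
      using spectrum_selfadjoint_real[OF assms] Reals_cases by metis
    then show "z \<in> complex_of_real ` {?s..?t}" using range z by blast
  qed
  have le: "?s \<le> ?t" using sub mem(2) by auto
  have least: "{?s..?t} \<subseteq> {a..b}" if "spectrum h \<subseteq> complex_of_real ` {a..b}" for a b
  proof -
    have "?t \<in> {a..b}" "?s \<in> {a..b}" using that mem by auto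
    then show ?thesis by auto
  qed
  show ?thesis
  proof
    assume *: "smallest_spectral_interval h s t"
    then have "{s..t} \<subseteq> {?s..?t}" "{?s..?t} \<subseteq> {s..t}" "s \<le> t"
      using sub least unfolding smallest_spectral_interval_def by auto
    then show "s = ?s \<and> t = ?t" using le by auto
  next
    assume "s = ?s \<and> t = ?t"
    then show "smallest_spectral_interval h s t"
      using le sub least unfolding smallest_spectral_interval_def by blast
  qed
qed

section \<open>The Hahn--Banach theorem for sublinear functionals\<close>

definition sublinear :: "('a::real_vector \<Rightarrow> real) \<Rightarrow> bool" where
  "sublinear p \<longleftrightarrow> (\<forall>x y. p (x + y) \<le> p x + p y) \<and> (\<forall>r>0. \<forall>x. p (r *\<^sub>R x) = r * p x)"

lemma sublinearD:
  assumes "sublinear p"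
  shows "p (x + y) \<le> p x + p y" "r > 0 \<Longrightarrow> p (r *\<^sub>R x) = r * p x" "p 0 = 0" "- p (- x) \<le> p x"
proof -
  show 1: "p (x + y) \<le> p x + p y" and 2: "r > 0 \<Longrightarrow> p (r *\<^sub>R x) = r * p x" for x y r
    using assms by (auto simp: sublinear_def)
  have "p (2 *\<^sub>R 0) = 2 * p 0" by (rule 2) simp
  then show 0: "p 0 = 0" by simp
  show "- p (- x) \<le> p x" using 1[of x "- x"] 0 by simp
qed

text \<open>
  For sublinear $p$ this is the largest sublinear functional below $p$ with value $-p(h)$ at $-h$.
\<close>

definition flatten :: "('a::real_vector \<Rightarrow> real) \<Rightarrow> 'a \<Rightarrow> 'a \<Rightarrow> real" where
  "flatten p h x = (INF s\<in>{0..}. p (x + s *\<^sub>R h) - s * p h)"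

lemma flatten_bdd_below:
  assumes "sublinear p"
  shows "bdd_below ((\<lambda>s. p (x + s *\<^sub>R h) - s * p h) ` {0..})"
proof (rule bdd_belowI2[where m = "- p (- x)"])
  fix s :: real assume s: "s \<in> {0..}"
  have "p (s *\<^sub>R h) = s * p h"
    using s sublinearD[OF assms] by (cases "s = 0") auto
  moreover have "p (s *\<^sub>R h) \<le> p (x + s *\<^sub>R h) + p (- x)"
    using sublinearD(1)[OF assms, of "x + s *\<^sub>R h" "- x"] by simp
  ultimately show "- p (- x) \<le> p (x + s *\<^sub>R h) - s * p h" by simp
qed

lemma flatten_le:
  assumes "sublinear p" "0 \<le> s"
  shows "flatten p h x \<le> p (x + s *\<^sub>R h) - s * p h"
  unfolding flatten_def using assms by (intro cINF_lower flatten_bdd_below) auto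

lemma flatten_less_obtain:
  assumes "flatten p h x < c"
  obtains s where "0 \<le> s" "p (x + s *\<^sub>R h) - s * p h < c"
  using cInf_lessD[OF _ assms[unfolded flatten_def]] by auto

lemma sublinear_flatten:
  assumes p: "sublinear p"
  shows "sublinear (flatten p h)"
  unfolding sublinear_def
proof (intro conjI allI impI)
  fix x y
  show "flatten p h (x + y) \<le> flatten p h x + flatten p h y"
  proof (rule field_le_epsilon)
    fix e :: real assume "e > 0"
    obtain s where s: "0 \<le> s" "p (x + s *\<^sub>R h) - s * p h < flatten p h x + e/2"
      using flatten_less_obtain[of p h x "flatten p h x + e/2"] \<open>e > 0\<close> by auto
    obtain t where t: "0 \<le> t" "p (y + t *\<^sub>R h) - t * p h < flatten p h y + e/2"
      using flatten_less_obtain[of p h y "flatten p h y + e/2"] \<open>e > 0\<close> by auto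
    have "flatten p h (x + y) \<le> p (x + y + (s + t) *\<^sub>R h) - (s + t) * p h"
      using s t by (intro flatten_le p) auto
    also have "x + y + (s + t) *\<^sub>R h = (x + s *\<^sub>R h) + (y + t *\<^sub>R h)" by (simp add: algebra_simps)
    also have "p \<dots> - (s + t) * p h
        \<le> (p (x + s *\<^sub>R h) - s * p h) + (p (y + t *\<^sub>R h) - t * p h)"
      using sublinearD(1)[OF p, of "x + s *\<^sub>R h" "y + t *\<^sub>R h"] by (simp add: algebra_simps)
    finally show "flatten p h (x + y) \<le> flatten p h x + flatten p h y + e" using s t by simp
  qed
next
  have le: "flatten p h (r *\<^sub>R x) \<le> r * flatten p h x" if r: "r > 0" for r x
  proof (rule field_le_epsilon)
    fix e :: real assume "e > 0"
    obtain s where s: "0 \<le> s" "p (x + s *\<^sub>R h) - s * p h < flatten p h x + e/r"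
      using flatten_less_obtain[of p h x "flatten p h x + e/r"] \<open>e > 0\<close> r by auto
    have "flatten p h (r *\<^sub>R x) \<le> p (r *\<^sub>R x + (r * s) *\<^sub>R h) - (r * s) * p h"
      using s r by (intro flatten_le p) auto
    also have "\<dots> = r * (p (x + s *\<^sub>R h) - s * p h)"
      using sublinearD(2)[OF p r, of "x + s *\<^sub>R h"] by (simp add: algebra_simps)
    also have "\<dots> \<le> r * (flatten p h x + e/r)" using s r by (intro mult_left_mono) auto
    finally show "flatten p h (r *\<^sub>R x) \<le> r * flatten p h x + e" using r by (simp add: algebra_simps)
  qed
  fix r :: real and x assume r: "r > 0"
  have "r * flatten p h x = r * flatten p h ((1/r) *\<^sub>R r *\<^sub>R x)" using r by simp
  also have "\<dots> \<le> r * ((1/r) * flatten p h (r *\<^sub>R x))"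
    using r by (intro mult_left_mono le) auto
  finally have "r * flatten p h x \<le> flatten p h (r *\<^sub>R x)" using r by simp
  then show "flatten p h (r *\<^sub>R x) = r * flatten p h x" using le[OF r, of x] by simp
qed

text \<open>
  Flattening a minimal functional cannot change it, so it is odd; an odd subadditive functional is
  additive.
\<close>

lemma linear_if_minimal_sublinear:
  assumes p: "sublinear p" and min: "\<And>q. sublinear q \<Longrightarrow> (\<And>x. q x \<le> p x) \<Longrightarrow> q = p"
  shows "linear p"
proof -
  have neg: "p (- h) = - p h" for h
  proof -
    have "flatten p h = p"
      using flatten_le[OF p, of 0 h] by (intro min sublinear_flatten p) auto
    then have "p (- h) \<le> - p h"
      using flatten_le[OF p, of 1 h "- h"] sublinearD(3)[OF p] by simp
    then show ?thesis using sublinearD(4)[OF p, of h] by simp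
  qed
  show ?thesis
  proof (rule linearI)
    fix x y
    show "p (x + y) = p x + p y"
      using sublinearD(1)[OF p, of x y] sublinearD(1)[OF p, of "- x" "- y"] neg[of "x + y"]
      by (simp add: neg)
  next
    fix r x
    show "p (r *\<^sub>R x) = r *\<^sub>R p x"
    proof (cases r "0 :: real" rule: linorder_cases)
      case less
      then show ?thesis using sublinearD(2)[OF p, of "- r" "- x"] by (simp add: neg)
    next
      case equal
      then show ?thesis using sublinearD(3)[OF p] by simp
    next
      case greater
      then show ?thesis using sublinearD(2)[OF p] by simp
    qed
  qed
qed

text \<open>
  The common upper bound $p$ keeps the infimum finite, because $q(x) \ge -q(-x) \ge -p(-x)$.
\<close>

lemma chain_infimum_sublinear:
  assumes "C \<noteq> {}" "\<And>q. q \<in> C \<Longrightarrow> sublinear q"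
    and chain: "\<And>q r. q \<in> C \<Longrightarrow> r \<in> C \<Longrightarrow> (\<forall>x. q x \<le> r x) \<or> (\<forall>x. r x \<le> q x)"
    and le: "\<And>q x. q \<in> C \<Longrightarrow> q x \<le> p x"
  shows "sublinear (\<lambda>x. INF q\<in>C. q x)" "\<And>q x. q \<in> C \<Longrightarrow> (INF q\<in>C. q x) \<le> q x"
proof -
  have bdd: "bdd_below ((\<lambda>q. q x) ` C)" for x
  proof (rule bdd_belowI2[where m = "- p (- x)"])
    fix q assume "q \<in> C"
    then show "- p (- x) \<le> q x"
      using sublinearD(4)[OF assms(2), of q x] le[of q "- x"] by simp
  qed
  show low: "(INF q\<in>C. q x) \<le> q x" if "q \<in> C" for q x
    using that bdd by (intro cINF_lower)
  let ?i = "\<lambda>x. INF q\<in>C. q x"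
  have near: "\<exists>q\<in>C. q x < ?i x + e" if "e > 0" for x e
    using cInf_lessD[of "(\<lambda>q. q x) ` C" "?i x + e"] assms(1) that by auto
  show "sublinear ?i"
    unfolding sublinear_def
  proof (intro conjI allI impI)
    fix x y
    show "?i (x + y) \<le> ?i x + ?i y"
    proof (rule field_le_epsilon)
      fix e :: real assume e: "e > 0"
      obtain q r where q: "q \<in> C" "q x < ?i x + e/2" and r: "r \<in> C" "r y < ?i y + e/2"
        using near[of "e/2" x] near[of "e/2" y] e by auto
      obtain m where m: "m \<in> C" "m x \<le> q x" "m y \<le> r y"
        using chain[OF q(1) r(1)] q(1) r(1) by blast
      have "?i (x + y) \<le> m (x + y)" by (rule low[OF m(1)])
      also have "\<dots> \<le> m x + m y" using assms(2)[OF m(1)] by (rule sublinearD)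
      finally show "?i (x + y) \<le> ?i x + ?i y + e" using m q r by simp
    qed
  next
    have le: "?i (r *\<^sub>R x) \<le> r * ?i x" if r: "r > 0" for r x
    proof (rule field_le_epsilon)
      fix e :: real assume e: "e > 0"
      obtain q where q: "q \<in> C" "q x < ?i x + e/r" using near[of "e/r" x] e r by auto
      have "?i (r *\<^sub>R x) \<le> q (r *\<^sub>R x)" by (rule low[OF q(1)])
      also have "\<dots> = r * q x" using sublinearD(2)[OF assms(2)[OF q(1)] r] .
      also have "\<dots> \<le> r * (?i x + e/r)" using q r by (intro mult_left_mono) auto
      finally show "?i (r *\<^sub>R x) \<le> r * ?i x + e" using r by (simp add: algebra_simps)
    qed
    fix r :: real and x assume r: "r > 0"
    have "r * ?i x = r * ?i ((1/r) *\<^sub>R r *\<^sub>R x)" using r by simp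
    also have "\<dots> \<le> r * ((1/r) * ?i (r *\<^sub>R x))"
      using r by (intro mult_left_mono le) auto
    finally have "r * ?i x \<le> ?i (r *\<^sub>R x)" using r by simp
    then show "?i (r *\<^sub>R x) = r * ?i x" using le[OF r, of x] by simp
  qed
qed

lemma ex_linear_below_sublinear:
  fixes p :: "'a::real_vector \<Rightarrow> real"
  assumes p: "sublinear p"
  obtains f where "linear f" "\<And>x. f x \<le> p x"
proof -
  define A where "A = {q. sublinear q \<and> (\<forall>x. q x \<le> p x)}"
  define P where "P = (\<lambda>q r :: 'a \<Rightarrow> real. \<forall>x. r x \<le> q x)"
  have "\<exists>m\<in>A. \<forall>a\<in>A. P m a \<longrightarrow> a = m"
  proof (rule predicate_Zorn)
    show "partial_order_on A (relation_of P A)"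
      by (rule partial_order_on_relation_ofI)
         (auto simp: P_def fun_eq_iff intro: order.trans antisym)
    fix C assume "C \<in> Chains (relation_of P A)"
    then have C: "C \<subseteq> A" "\<And>q r. q \<in> C \<Longrightarrow> r \<in> C \<Longrightarrow> P q r \<or> P r q"
      by (auto simp: Chains_def relation_of_def)
    show "\<exists>u\<in>A. \<forall>a\<in>C. P a u"
    proof (cases "C = {}")
      case True
      then show ?thesis using p by (auto simp: A_def)
    next
      case False
      have *: "sublinear q" "q x \<le> p x" if "q \<in> C" for q x using C that by (auto simp: A_def)
      have c: "(\<forall>x. q x \<le> r x) \<or> (\<forall>x. r x \<le> q x)" if "q \<in> C" "r \<in> C" for q r
        using C(2)[OF that] by (auto simp: P_def)
      have i: "sublinear (\<lambda>x. INF q\<in>C. q x)" "\<And>q x. q \<in> C \<Longrightarrow> (INF q\<in>C. q x) \<le> q x"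
        using chain_infimum_sublinear[where C=C and p=p] False * c by blast+
      have "(INF q\<in>C. q x) \<le> p x" for x using False i(2) *(2) order.trans by blast
      then have "(\<lambda>x. INF q\<in>C. q x) \<in> A" using i by (auto simp: A_def)
      then show ?thesis using i(2) by (intro bexI[of _ "\<lambda>x. INF q\<in>C. q x"]) (auto simp: P_def)
    qed
  qed
  then obtain m where m: "m \<in> A" "\<And>a. a \<in> A \<Longrightarrow> P m a \<Longrightarrow> a = m" by blast
  have "linear m"
  proof (rule linear_if_minimal_sublinear)
    fix q assume "sublinear q" "\<And>x. q x \<le> m x"
    then show "q = m"
      using m(1) by (intro m(2)) (auto simp: A_def P_def intro: order.trans)
  qed (use m in \<open>auto simp: A_def\<close>)
  then show ?thesis using m that by (auto simp: A_def)
qed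

text \<open>
  A linear functional below the flattening of $p$ at $h$ takes the value $p(h)$ at $h$.
\<close>

theorem Hahn_Banach_sublinear:
  fixes p :: "'a::real_vector \<Rightarrow> real"
  assumes p: "sublinear p"
  obtains f where "linear f" "\<And>x. f x \<le> p x" "f h = p h"
proof -
  obtain f where f: "linear f" "\<And>x. f x \<le> flatten p h x"
    using ex_linear_below_sublinear[OF sublinear_flatten[OF p]] by metis
  have le: "f x \<le> p x" for x using f(2)[of x] flatten_le[OF p, of 0 h x] by simp
  have "f (- h) \<le> - p h"
    using f(2)[of "- h"] flatten_le[OF p, of 1 h "- h"] sublinearD(3)[OF p] by simp
  then have "f h = p h" using le[of h] by (simp add: linear_neg[OF f(1)])
  then show ?thesis using that f(1) le by blast
qed

section \<open>States\<close>

definition real_part :: "'a::cstar_algebra \<Rightarrow> 'a" where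
  "real_part a = (1/2) *\<^sub>R (a + star a)"

lemma star_real_part: "star (real_part a) = real_part a"
  by (simp add: real_part_def star_scaleR star_add star_star add.commute)

lemma real_part_add: "real_part (a + b) = real_part a + real_part b"
  by (simp add: real_part_def star_add algebra_simps)

lemma real_part_scaleR: "real_part (r *\<^sub>R a) = r *\<^sub>R real_part a"
  by (simp add: real_part_def star_scaleR algebra_simps)

lemma real_part_selfadjoint: "star a = a \<Longrightarrow> real_part a = a"
  by (simp add: real_part_def flip: scaleR_2)

text \<open>
  Taking real parts extends the upper bound from self-adjoint elements to the whole algebra, which is a
  real vector space, so that the Hahn--Banach theorem applies to it.
\<close>

lemma sublinear_upper_bound: "sublinear (\<lambda>a :: 'a::cstar_algebra. upper_bound (real_part a))"
  unfolding sublinear_def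
proof (intro conjI allI impI)
  fix x y :: 'a
  have "positive ((of_real (upper_bound (real_part x)) - real_part x)
      + (of_real (upper_bound (real_part y)) - real_part y))"
    by (intro positive_add positive_upper_bound_minus star_real_part)
  then have "positive (of_real (upper_bound (real_part x) + upper_bound (real_part y)) - real_part (x + y))"
    by (simp add: real_part_add algebra_simps)
  then show "upper_bound (real_part (x + y)) \<le> upper_bound (real_part x) + upper_bound (real_part y)"
    by (intro upper_bound_le star_real_part)
next
  have le: "upper_bound (real_part (r *\<^sub>R x)) \<le> r * upper_bound (real_part x)"
    if "r > 0" for r and x :: 'a
  proof -
    have "positive (r *\<^sub>R (of_real (upper_bound (real_part x)) - real_part x))"
      using that by (intro positive_scaleR positive_upper_bound_minus star_real_part) auto
    then show ?thesis
      by (intro upper_bound_le star_real_part) (simp add: real_part_scaleR algebra_simps of_real_def)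
  qed
  fix r :: real and x :: 'a assume r: "r > 0"
  have "r * upper_bound (real_part x) = r * upper_bound (real_part ((1/r) *\<^sub>R r *\<^sub>R x))" using r by simp
  also have "\<dots> \<le> r * ((1/r) * upper_bound (real_part (r *\<^sub>R x)))"
    using r by (intro mult_left_mono le) auto
  finally show "upper_bound (real_part (r *\<^sub>R x)) = r * upper_bound (real_part x)"
    using le[OF r, of x] r by simp
qed

lemma stateD:
  assumes "state \<phi>"
  shows "\<phi> (x + y) = \<phi> x + \<phi> y" "\<phi> (a *\<^sub>C x) = a * \<phi> x" "\<phi> 1 = 1"
    "\<phi> (star x * x) \<in> \<real>" "0 \<le> Re (\<phi> (star x * x))"
  using assms unfolding state_def by auto

text \<open>
  A real functional $f$ below the upper bound is nonnegative on positive elements, because $-a$ has upper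
  bound at most $0$ for positive $a$; it is $1$ at $1$ and vanishes on skew-adjoint elements. Its complexification
  $f(a) - i f(ia)$ is the desired state.
\<close>

lemma state_exists_at_upper_bound:
  fixes h :: "'a::cstar_algebra"
  assumes h: "star h = h"
  obtains \<phi> where "state \<phi>" "\<phi> h = complex_of_real (upper_bound h)"
proof -
  obtain f :: "'a \<Rightarrow> real" where f: "linear f" "\<And>x. f x \<le> upper_bound (real_part x)"
    "f h = upper_bound (real_part h)"
    using Hahn_Banach_sublinear[OF sublinear_upper_bound] by metis
  have f_le: "f a \<le> t" if "star a = a" "positive (of_real t - a)" for a t
    using f(2)[of a] upper_bound_le[OF that] that by (simp add: real_part_selfadjoint)
  have pos: "0 \<le> f a" if "positive a" for a
    using f_le[of "- a" 0] that by (simp add: star_minus positive_selfadjoint linear_neg[OF f(1)])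
  have "f 1 \<le> 1" using f_le[of 1 1] positive_of_real[of 0, where 'a='a] by simp
  moreover have "f (- 1) \<le> - 1"
    using f_le[of "- 1" "- 1"] positive_of_real[of 0, where 'a='a] by (simp add: star_minus)
  ultimately have f1: "f 1 = 1" by (simp add: linear_neg[OF f(1)])
  have skew: "f a = 0" if "star a = - a" for a
  proof -
    have "real_part a = 0" "real_part (- a) = 0" using that by (auto simp: real_part_def star_minus)
    moreover have "upper_bound (0::'a) \<le> 0"
      using positive_of_real[of 0, where 'a='a] by (intro upper_bound_le) auto
    ultimately show ?thesis using f(2)[of a] f(2)[of "- a"] by (simp add: linear_neg[OF f(1)])
  qed
  have iskew: "f (\<i> *\<^sub>C a) = 0" if "star a = a" for a
    by (rule skew) (simp add: that star_scaleC scaleC_minus_left)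
  define \<phi> where "\<phi> = (\<lambda>a. complex_of_real (f a) - \<i> * complex_of_real (f (\<i> *\<^sub>C a)))"
  have add: "\<phi> (x + y) = \<phi> x + \<phi> y" for x y
    by (simp add: \<phi>_def scaleC_add_right linear_add[OF f(1)] algebra_simps)
  have real: "\<phi> (complex_of_real r *\<^sub>C x) = r * \<phi> x" for r x
  proof -
    have "\<i> *\<^sub>C complex_of_real r *\<^sub>C x = complex_of_real r *\<^sub>C \<i> *\<^sub>C x"
      by (simp add: scaleC_scaleC mult.commute)
    then show ?thesis
      by (simp add: \<phi>_def scaleC_of_real linear_scale[OF f(1)] algebra_simps)
  qed
  have imag: "\<phi> (\<i> *\<^sub>C x) = \<i> * \<phi> x" for x
    by (simp add: \<phi>_def scaleC_scaleC scaleC_minus_left linear_neg[OF f(1)] algebra_simps)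
  have scale: "\<phi> (a *\<^sub>C x) = a * \<phi> x" for a x
  proof -
    have "a *\<^sub>C x = complex_of_real (Re a) *\<^sub>C x + complex_of_real (Im a) *\<^sub>C \<i> *\<^sub>C x"
      using complex_eq[of a] by (simp add: scaleC_scaleC mult.commute flip: scaleC_add_left)
    then have "\<phi> (a *\<^sub>C x) = (Re a + \<i> * Im a) * \<phi> x"
      by (simp add: add real imag algebra_simps)
    then show ?thesis by (simp flip: complex_eq)
  qed
  have sa: "\<phi> a = complex_of_real (f a)" if "star a = a" for a
    using iskew[OF that] by (simp add: \<phi>_def)
  have "\<phi> (star x * x) = complex_of_real (f (star x * x))" for x
    by (rule sa) (simp add: star_mult star_star)
  then have "state \<phi>"
    unfolding state_def using add scale sa[of 1] f1 pos[OF positive_star_mult] by auto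
  moreover have "\<phi> h = complex_of_real (upper_bound h)"
    using sa[OF h] f(3) by (simp add: real_part_selfadjoint h)
  ultimately show ?thesis by (rule that)
qed

lemma state_minus: "state \<phi> \<Longrightarrow> \<phi> (- x) = - \<phi> x"
  using stateD(2)[of \<phi> "-1" x] by (simp add: scaleC_minus_left)

lemma state_diff: "state \<phi> \<Longrightarrow> \<phi> (x - y) = \<phi> x - \<phi> y"
  using stateD(1)[of \<phi> x "- y"] by (simp add: state_minus)

lemma state_of_real: "state \<phi> \<Longrightarrow> \<phi> (of_real r) = of_real r"
  using stateD(2)[of \<phi> "of_real r" 1] by (simp add: stateD(3) scaleC_of_real_1)

lemma state_positive:
  assumes "state \<phi>" "positive a"
  shows "\<phi> a \<in> \<real>" "0 \<le> Re (\<phi> a)"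
proof -
  obtain y where "positive y" "y * y = a" using positive_sqrt[OF assms(2)] by metis
  then have "a = star y * y" by (simp add: positive_selfadjoint)
  then show "\<phi> a \<in> \<real>" "0 \<le> Re (\<phi> a)" using stateD[OF assms(1)] by auto
qed

lemma state_selfadjoint_le:
  fixes a :: "'a::cstar_algebra"
  assumes "state \<phi>" "star a = a"
  shows "\<phi> a \<in> \<real>" "Re (\<phi> a) \<le> upper_bound a"
proof -
  define b where "b = of_real (upper_bound a) - a"
  have "positive b" unfolding b_def by (rule positive_upper_bound_minus[OF assms(2)])
  then have "\<phi> b \<in> \<real>" "0 \<le> Re (\<phi> b)" using state_positive assms(1) by auto
  moreover have "\<phi> b = of_real (upper_bound a) - \<phi> a"
    using assms by (simp add: b_def state_diff state_of_real)
  ultimately show "\<phi> a \<in> \<real>" "Re (\<phi> a) \<le> upper_bound a"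
    by (auto simp: complex_is_Real_iff)
qed

lemma state_star:
  fixes x :: "'a::cstar_algebra"
  assumes "state \<phi>"
  shows "\<phi> (star x) = cnj (\<phi> x)"
proof -
  have 1: "\<phi> (x + star x) \<in> \<real>"
    by (intro state_selfadjoint_le assms) (simp add: star_add star_star add.commute)
  have 2: "\<phi> (\<i> *\<^sub>C (x - star x)) \<in> \<real>"
    by (intro state_selfadjoint_le assms) (simp add: star_scaleC star_diff star_star scaleC_minus_left scaleC_diff_right)
  show ?thesis using 1 2
    by (simp add: stateD(1,2)[OF assms] state_diff[OF assms] complex_is_Real_iff complex_eq_iff)
qed

text \<open>
  With $l = \varphi(x)$, positivity at $x - l$ gives $|l|^2 \le \varphi(x^*x)$, and $\|x\|^2 - x^*x$ is positive.
\<close>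

lemma state_norm_le:
  fixes x :: "'a::cstar_algebra"
  assumes s: "state \<phi>"
  shows "cmod (\<phi> x) \<le> norm x"
proof -
  define l where "l = \<phi> x"
  define y where "y = x - l *\<^sub>C 1"
  have "star y * y = star x * x - l *\<^sub>C star x - cnj l *\<^sub>C x + (cnj l * l) *\<^sub>C 1"
    by (simp add: y_def star_diff star_scaleC algebra_simps mult_scaleC_left mult_scaleC_right
       scaleC_scaleC scaleC_diff_right)
  then have "\<phi> (star y * y) = \<phi> (star x * x) - cnj l * l"
    by (simp add: stateD[OF s] state_diff[OF s] state_star[OF s] l_def)
  then have 1: "(cmod l)\<^sup>2 \<le> Re (\<phi> (star x * x))"
    using stateD(5)[OF s, of y] by (simp add: cmod_power2) (simp add: power2_eq_square)
  define b where "b = of_real ((norm x)\<^sup>2) - star x * x"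
  have "positive b"
    using positive_norm_minus[of "star x * x"] by (simp add: b_def cstar_identity star_mult star_star)
  then have "0 \<le> Re (\<phi> b)" by (rule state_positive[OF s])
  then have "Re (\<phi> (star x * x)) \<le> (norm x)\<^sup>2"
    unfolding b_def state_diff[OF s] state_of_real[OF s] by simp
  with 1 show ?thesis by (simp add: l_def power2_le_imp_le)
qed

lemma bounded_linear_state:
  assumes "state \<phi>"
  shows "bounded_linear \<phi>"
proof (rule bounded_linear_intro[where K=1])
  fix r x show "\<phi> (r *\<^sub>R x) = r *\<^sub>R \<phi> x"
    using stateD(2)[OF assms, of "of_real r" x] by (simp add: scaleC_of_real scaleR_conv_of_real)
qed (use stateD[OF assms] state_norm_le[OF assms] in auto)

section \<open>Rapidly decreasing double sequences\<close>

lemma int_weight_summable: "(\<lambda>m::int. 1 / (1 + \<bar>real_of_int m\<bar>)\<^sup>2) summable_on UNIV"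
proof -
  let ?g = "\<lambda>m::int. 1 / (1 + \<bar>real_of_int m\<bar>)\<^sup>2"
  have "summable (\<lambda>n. inverse (real (Suc n) ^ 2))"
    by (subst summable_Suc_iff) (rule inverse_power_summable, simp)
  then have "(\<lambda>n. inverse (real (Suc n) ^ 2)) summable_on UNIV"
    by (intro summable_nonneg_imp_summable_on) auto
  then have s: "(?g \<circ> int) summable_on UNIV" "(?g \<circ> (\<lambda>n. - int n)) summable_on UNIV"
    by (simp_all add: o_def inverse_eq_divide add.commute)
  have inj: "inj (\<lambda>n. - int n)" by (simp add: inj_on_def)
  have "?g summable_on range int" "?g summable_on range (\<lambda>n. - int n)"
    using s summable_on_reindex[of int UNIV ?g] summable_on_reindex[OF inj, of ?g] by auto
  then have "?g summable_on range int \<union> (range (\<lambda>n. - int n) - range int)"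
    by (intro summable_on_Un_disjoint) (auto intro: summable_on_subset_banach)
  moreover have "range int \<union> (range (\<lambda>n. - int n) - range int) = UNIV"
  proof -
    have "m \<in> range int \<or> m \<in> range (\<lambda>n. - int n)" for m
      by (metis int_cases2 rangeI)
    then show ?thesis by auto
  qed
  ultimately show ?thesis by simp
qed

lemma int_pair_weight_summable:
  "(\<lambda>(m::int, n::int). 1 / ((1 + \<bar>real_of_int m\<bar>)\<^sup>2 * (1 + \<bar>real_of_int n\<bar>)\<^sup>2)) summable_on UNIV"
proof -
  let ?g = "\<lambda>m::int. 1 / (1 + \<bar>real_of_int m\<bar>)\<^sup>2"
  have "(\<lambda>(m, n). ?g m * ?g n) summable_on Sigma UNIV (\<lambda>_. UNIV)"
  proof (rule summable_on_SigmaI)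
    fix m
    show "((\<lambda>n. case (m, n) of (m, n) \<Rightarrow> ?g m * ?g n) has_sum ?g m * infsum ?g UNIV) UNIV"
      using has_sum_cmult_right[OF has_sum_infsum[OF int_weight_summable], of "?g m"] by simp
  next
    show "(\<lambda>m. ?g m * infsum ?g UNIV) summable_on UNIV"
      by (rule summable_on_cmult_left) (rule int_weight_summable)
  qed auto
  then show ?thesis by (simp add: case_prod_unfold)
qed

text \<open>
  Four extra powers of $1 + |m| + |n|$ dominate the weight $(1+|m|)^2 (1+|n|)^2$, whose inverse is summable.
\<close>

lemma rapidly_decreasing_abs_summable:
  assumes "rapidly_decreasing c"
  shows "(\<lambda>(m, n). cmod (c m n) * (1 + \<bar>real_of_int m\<bar> + \<bar>real_of_int n\<bar>) ^ k) summable_on UNIV"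
proof -
  obtain C where C: "\<And>m n. cmod (c m n) * (1 + \<bar>real_of_int m\<bar> + \<bar>real_of_int n\<bar>) ^ (k + 4) \<le> C"
    using assms unfolding rapidly_decreasing_def by metis
  let ?w = "\<lambda>(m::int, n::int). 1 / ((1 + \<bar>real_of_int m\<bar>)\<^sup>2 * (1 + \<bar>real_of_int n\<bar>)\<^sup>2)"
  have "(\<lambda>x. C * ?w x) summable_on UNIV"
    by (intro summable_on_cmult_right int_pair_weight_summable)
  then show ?thesis
  proof (rule summable_on_comparison_test)
    fix x :: "int \<times> int"
    obtain m n where x: "x = (m, n)" by fastforce
    define a b r where "a = 1 + \<bar>real_of_int m\<bar>" and "b = 1 + \<bar>real_of_int n\<bar>"
      and "r = 1 + \<bar>real_of_int m\<bar> + \<bar>real_of_int n\<bar>"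
    have ab: "a \<ge> 1" "b \<ge> 1" "a \<le> r" "b \<le> r" by (auto simp: a_def b_def r_def)
    have "(cmod (c m n) * r ^ k) * (a\<^sup>2 * b\<^sup>2) \<le> (cmod (c m n) * r ^ k) * (r\<^sup>2 * r\<^sup>2)"
      using ab by (intro mult_left_mono mult_mono power_mono) auto
    also have "\<dots> = cmod (c m n) * r ^ (k + 4)" by (simp add: power_add algebra_simps flip: power_add)
    also have "\<dots> \<le> C" using C[of m n] by (simp add: r_def)
    finally have "cmod (c m n) * r ^ k \<le> C / (a\<^sup>2 * b\<^sup>2)"
      using ab by (simp add: pos_le_divide_eq)
    then show "(case x of (m, n) \<Rightarrow> cmod (c m n) * (1 + \<bar>real_of_int m\<bar> + \<bar>real_of_int n\<bar>) ^ k) \<le> C * ?w x"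
      by (simp add: x a_def b_def r_def)
  qed auto
qed

lemma rapidly_decreasing_mult:
  assumes "rapidly_decreasing c"
    and b: "\<And>m n. cmod (b m n) \<le> K * (1 + \<bar>real_of_int m\<bar> + \<bar>real_of_int n\<bar>) ^ j"
  shows "rapidly_decreasing (\<lambda>m n. b m n * c m n)"
  unfolding rapidly_decreasing_def
proof
  fix k
  obtain C where C: "\<And>m n. cmod (c m n) * (1 + \<bar>real_of_int m\<bar> + \<bar>real_of_int n\<bar>) ^ (j + k) \<le> C"
    using assms unfolding rapidly_decreasing_def by metis
  have K: "K \<ge> 0" using order.trans[OF norm_ge_zero b[of 0 0]] by simp
  have "cmod (b m n * c m n) * (1 + \<bar>real_of_int m\<bar> + \<bar>real_of_int n\<bar>) ^ k \<le> K * C" for m n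
  proof -
    define r where "r = 1 + \<bar>real_of_int m\<bar> + \<bar>real_of_int n\<bar>"
    have r: "r \<ge> 0" by (simp add: r_def)
    have "cmod (b m n) * (cmod (c m n) * r ^ k) \<le> (K * r ^ j) * (cmod (c m n) * r ^ k)"
      using b[of m n] r by (intro mult_right_mono) (auto simp: r_def)
    also have "\<dots> = K * (cmod (c m n) * r ^ (j + k))" by (simp add: power_add)
    also have "\<dots> \<le> K * C" using C[of m n] K by (intro mult_left_mono) (auto simp: r_def)
    finally show ?thesis by (simp add: norm_mult r_def)
  qed
  then show "\<exists>C. \<forall>m n. cmod (b m n * c m n) * (1 + \<bar>real_of_int m\<bar> + \<bar>real_of_int n\<bar>) ^ k \<le> C"
    by blast
qed

lemma rapidly_decreasing_uminus: "rapidly_decreasing c \<Longrightarrow> rapidly_decreasing (\<lambda>m n. - c m n)"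
  using rapidly_decreasing_mult[of c "\<lambda>_ _. - 1" 1 0] by simp

lemma rapidly_decreasing_diff:
  assumes "rapidly_decreasing c" "rapidly_decreasing d"
  shows "rapidly_decreasing (\<lambda>m n. c m n - d m n)"
  unfolding rapidly_decreasing_def
proof
  fix k
  obtain C D where C: "\<And>m n. cmod (c m n) * (1 + \<bar>real_of_int m\<bar> + \<bar>real_of_int n\<bar>) ^ k \<le> C"
    and D: "\<And>m n. cmod (d m n) * (1 + \<bar>real_of_int m\<bar> + \<bar>real_of_int n\<bar>) ^ k \<le> D"
    using assms unfolding rapidly_decreasing_def by metis
  have "cmod (c m n - d m n) * (1 + \<bar>real_of_int m\<bar> + \<bar>real_of_int n\<bar>) ^ k \<le> C + D" for m n
  proof -
    have "cmod (c m n - d m n) * (1 + \<bar>real_of_int m\<bar> + \<bar>real_of_int n\<bar>) ^ k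
        \<le> (cmod (c m n) + cmod (d m n)) * (1 + \<bar>real_of_int m\<bar> + \<bar>real_of_int n\<bar>) ^ k"
      by (intro mult_right_mono norm_triangle_ineq4) auto
    also have "\<dots> \<le> C + D" using C[of m n] D[of m n] by (simp add: distrib_right)
    finally show ?thesis .
  qed
  then show "\<exists>C. \<forall>m n. cmod (c m n - d m n) * (1 + \<bar>real_of_int m\<bar> + \<bar>real_of_int n\<bar>) ^ k \<le> C"
    by blast
qed

lemma rapidly_decreasing_derivative:
  assumes "rapidly_decreasing c"
  shows "rapidly_decreasing (\<lambda>m n. 2 * pi * \<i> * of_int m * c m n)"
    "rapidly_decreasing (\<lambda>m n. 2 * pi * \<i> * of_int n * c m n)"
  by (rule rapidly_decreasing_mult[OF assms, where K = "2 * pi" and j = 1], simp add: norm_mult)+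

section \<open>Uniqueness of double Fourier series\<close>

lemma has_sum_sum:
  fixes f :: "'i \<Rightarrow> 'x \<Rightarrow> 'b::topological_comm_monoid_add"
  assumes "finite I" "\<And>i. i \<in> I \<Longrightarrow> (f i has_sum s i) A"
  shows "((\<lambda>x. \<Sum>i\<in>I. f i x) has_sum (\<Sum>i\<in>I. s i)) A"
  using assms by (induction I) (auto intro: has_sum_add)

lemma sum_roots_of_unity:
  fixes k :: int and N :: nat
  assumes "N > 0" "\<bar>k\<bar> < int N"
  shows "(\<Sum>i<N. cis (2 * pi * real i / real N * real_of_int k)) = (if k = 0 then of_nat N else 0)"
proof (cases "k = 0")
  case False
  define x where "x = cis (2 * pi * real_of_int k / real N)"
  have pw: "cis (2 * pi * real i / real N * real_of_int k) = x ^ i" for i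
  proof -
    have "2 * pi * real i / real N * real_of_int k = real i * (2 * pi * real_of_int k / real N)" by simp
    then show ?thesis by (simp only: x_def Complex.DeMoivre)
  qed
  have "x ^ N = cis (2 * pi * real_of_int k)" using assms by (simp add: x_def Complex.DeMoivre)
  then have xN: "x ^ N = 1" by simp
  have "x \<noteq> 1"
  proof
    assume "x = 1"
    then have "cos (2 * pi * real_of_int k / real N) = 1" by (simp add: x_def complex_eq_iff)
    then obtain l :: int where "2 * pi * real_of_int k / real N = l * 2 * pi"
      unfolding cos_one_2pi_int by auto
    then have "real_of_int k = real_of_int (l * int N)" using assms by (simp add: field_simps)
    then have "k = l * int N" by (simp only: of_int_eq_iff)
    then show False using assms False by (auto simp: abs_mult)
  qed
  then have "(\<Sum>i<N. x ^ i) = 0" using xN by (simp add: geometric_sum)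
  then show ?thesis unfolding pw using False by simp
qed auto

text \<open>
  Averaging the series over $N$-th roots of unity in both variables keeps the coefficient at $(m,n)$ and
  annihilates every other one whose indices differ from $m$ and $n$ by less than $N$. Choose a finite set
  $F$ that carries all but $e$ of the absolute sum, and $N$ so large that this applies to all of $F$; what
  survives besides the coefficient at $(m,n)$ is then at most $e$.
\<close>

lemma double_fourier_series_zero_coeff:
  fixes g :: "int \<times> int \<Rightarrow> complex"
  assumes g: "(\<lambda>x. cmod (g x)) summable_on UNIV"
    and zero: "\<And>s t. ((\<lambda>(k, l). g (k, l) * cis (s * of_int (k - m) + t * of_int (l - n))) has_sum 0) UNIV"
  shows "g (m, n) = 0"
proof -
  have "cmod (g (m, n)) \<le> e" if "e > 0" for e
  proof -
    obtain G where G: "finite G" "dist (\<Sum>x\<in>G. cmod (g x)) (\<Sum>\<^sub>\<infinity>x. cmod (g x)) \<le> e"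
      using infsum_finite_approximation[OF g \<open>e > 0\<close>] by auto
    have sub: "(\<lambda>x. cmod (g x)) summable_on A" for A
      using g by (rule summable_on_subset_banach) auto
    have "(\<Sum>\<^sub>\<infinity>x. cmod (g x)) = (\<Sum>x\<in>G. cmod (g x)) + (\<Sum>\<^sub>\<infinity>x\<in>-G. cmod (g x))"
      using infsum_Un_disjoint[OF sub sub, of G "- G"] G by simp
    then have "(\<Sum>\<^sub>\<infinity>x\<in>-G. cmod (g x)) \<le> e"
      using G(2) by (simp add: dist_real_def)
    \<comment> \<open>With (m, n) in F, the complement of F does not count the coefficient to be isolated.\<close>
    define F where "F = insert (m, n) G"
    have F: "finite F" "(m, n) \<in> F" using G by (auto simp: F_def)
    have "(\<Sum>\<^sub>\<infinity>x\<in>-F. cmod (g x)) \<le> (\<Sum>\<^sub>\<infinity>x\<in>-G. cmod (g x))"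
      by (intro infsum_mono2 sub) (auto simp: F_def)
    with \<open>(\<Sum>\<^sub>\<infinity>x\<in>-G. cmod (g x)) \<le> e\<close> have tail: "(\<Sum>\<^sub>\<infinity>x\<in>-F. cmod (g x)) \<le> e" by simp
    define N where "N = Suc (nat (Max ((\<lambda>(k, l). max \<bar>k - m\<bar> \<bar>l - n\<bar>) ` F)))"
    have N: "\<bar>k - m\<bar> < int N \<and> \<bar>l - n\<bar> < int N" if "(k, l) \<in> F" for k l
    proof -
      have "max \<bar>k - m\<bar> \<bar>l - n\<bar> \<le> Max ((\<lambda>(k, l). max \<bar>k - m\<bar> \<bar>l - n\<bar>) ` F)"
        using F that by (intro Max_ge) force+
      then show ?thesis unfolding N_def by linarith
    qed
    have N0: "N > 0" by (simp add: N_def)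
    \<comment> \<open>Sums in place of averages: the factor \<open>N\<^sup>2\<close> is cancelled at the end.\<close>
    define A where "A k = (\<Sum>i<N. cis (2 * pi * real i / real N * real_of_int k))" for k
    have A_norm: "cmod (A k) \<le> N" for k
      unfolding A_def by (rule order.trans[OF norm_sum]) simp
    define f where "f x = g x * (A (fst x - m) * A (snd x - n))" for x
    have fs: "f (k, l) = (\<Sum>i<N. \<Sum>j<N. g (k, l) *
        cis (2 * pi * real i / real N * of_int (k - m) + 2 * pi * real j / real N * of_int (l - n)))"
      for k l
      unfolding f_def A_def fst_conv snd_conv sum_product
      by (simp only: sum_distrib_left cis_mult)
    have "((\<lambda>x. \<Sum>i<N. \<Sum>j<N. (case x of (k, l) \<Rightarrow> g (k, l) *
        cis (2 * pi * real i / real N * of_int (k - m) + 2 * pi * real j / real N * of_int (l - n))))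
        has_sum (\<Sum>i<N. \<Sum>j<N. 0)) UNIV"
      by (intro has_sum_sum zero) auto
    also have "(\<lambda>x. \<Sum>i<N. \<Sum>j<N. (case x of (k, l) \<Rightarrow> g (k, l) *
        cis (2 * pi * real i / real N * of_int (k - m) + 2 * pi * real j / real N * of_int (l - n)))) = f"
      using fs by (simp add: fun_eq_iff)
    finally have f0: "(f has_sum 0) UNIV" by simp
    then have "f summable_on UNIV" by (auto simp: summable_on_def)
    then have "f summable_on UNIV - {(m, n)}" by (rule summable_on_subset_banach) simp
    then obtain S where S: "(f has_sum S) (UNIV - {(m, n)})" by (auto simp: summable_on_def)
    then have "(f has_sum (f (m, n) + S)) (insert (m, n) (UNIV - {(m, n)}))"
      by (intro has_sum_insert) auto
    then have S0: "f (m, n) + S = 0" using f0 by (simp add: insert_absorb has_sum_unique)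
    have fmn: "f (m, n) = g (m, n) * N\<^sup>2"
      using sum_roots_of_unity[OF N0, of 0] N0 by (simp add: f_def A_def power2_eq_square)
    let ?b = "\<lambda>x. if x \<in> F then 0 else cmod (g x) * N\<^sup>2"
    have "((\<lambda>x. cmod (g x) * N\<^sup>2) has_sum (\<Sum>\<^sub>\<infinity>x\<in>-F. cmod (g x)) * N\<^sup>2) (- F)"
      by (intro has_sum_cmult_left has_sum_infsum sub)
    also have "?this \<longleftrightarrow> (?b has_sum (\<Sum>\<^sub>\<infinity>x\<in>-F. cmod (g x)) * N\<^sup>2) (UNIV - {(m, n)})"
      using F(2) by (intro has_sum_cong_neutral) auto
    finally have "norm S \<le> (\<Sum>\<^sub>\<infinity>x\<in>-F. cmod (g x)) * N\<^sup>2"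
    proof (rule norm_infsum_le[OF S])
      fix x assume x: "x \<in> UNIV - {(m, n)}"
      obtain k l where kl: "x = (k, l)" by fastforce
      show "cmod (f x) \<le> ?b x"
      proof (cases "x \<in> F")
        case True
        then have "A (k - m) = 0 \<or> A (l - n) = 0"
          using x N[of k l] sum_roots_of_unity[OF N0, of "k - m"]
            sum_roots_of_unity[OF N0, of "l - n"] by (auto simp: kl A_def)
        then show ?thesis using True by (auto simp: f_def kl)
      next
        case False
        have "cmod (f x) = cmod (g x) * (cmod (A (k - m)) * cmod (A (l - n)))"
          by (simp add: f_def kl norm_mult)
        also have "\<dots> \<le> cmod (g x) * (real N * real N)"
          by (intro mult_left_mono mult_mono A_norm) auto
        finally show ?thesis using False by (simp add: power2_eq_square)
      qed
    qed
    also have "norm S = cmod (g (m, n)) * N\<^sup>2"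
      using S0 fmn by (metis add_eq_0_iff norm_minus_cancel norm_mult norm_of_nat)
    finally have "cmod (g (m, n)) \<le> (\<Sum>\<^sub>\<infinity>x\<in>-F. cmod (g x))" using N0 by simp
    with tail show ?thesis by simp
  qed
  then have "cmod (g (m, n)) \<le> 0" using field_le_epsilon[of "cmod (g (m, n))" 0] by simp
  then show ?thesis by simp
qed

section \<open>The torus action on the rotation algebra\<close>

lemma cos_second_difference: "\<bar>(x::real)\<^sup>2 - (2 - 2 * cos x)\<bar> \<le> x ^ 4"
proof -
  obtain t where "cos x = (\<Sum>m<4. cos_coeff m * x ^ m) + (cos (t + 1/2 * real 4 * pi) / fact 4) * x ^ 4"
    using Maclaurin_cos_expansion[of x 4] by blast
  moreover have "(\<Sum>m<4. cos_coeff m * x ^ m) = 1 - x\<^sup>2 / 2"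
  proof -
    have "(\<Sum>m<4. cos_coeff m * x ^ m)
        = cos_coeff 0 + cos_coeff 1 * x + cos_coeff 2 * x\<^sup>2 + cos_coeff 3 * x ^ 3"
      by (simp add: eval_nat_numeral)
    then show ?thesis by (simp add: cos_coeff_def)
  qed
  ultimately have "x\<^sup>2 - (2 - 2 * cos x) = cos (t + 2 * pi) / 12 * x ^ 4"
    by (simp add: fact_numeral mult.commute)
  also have "\<bar>\<dots>\<bar> = (\<bar>cos (t + 2 * pi)\<bar> / 12) * x ^ 4" by (simp add: abs_mult)
  also have "\<dots> \<le> 1 * x ^ 4"
    by (intro mult_right_mono) (auto intro: order.trans[OF abs_cos_le_one])
  finally show ?thesis by simp
qed

definition monomial :: "'a::cstar_algebra \<Rightarrow> 'a \<Rightarrow> int \<times> int \<Rightarrow> 'a" where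
  "monomial U V = (\<lambda>(m, n). unitary_power U m * unitary_power V n)"

lemma fourier_sum_monomial:
  "fourier_sum U V c = (\<Sum>\<^sub>\<infinity>x. (case x of (m, n) \<Rightarrow> c m n) *\<^sub>C monomial U V x)"
  by (simp add: fourier_sum_def monomial_def case_prod_unfold)

lemma unitary_unitary_power:
  assumes "star u * u = 1" "u * star u = 1"
  shows "star (unitary_power u m) * unitary_power u m = (1::'a::cstar_algebra)"
proof -
  have *: "star v ^ n * v ^ n = 1" if "star v * v = 1" for v :: 'a and n
  proof (induction n)
    case (Suc n)
    have "star v ^ Suc n * v ^ Suc n = star v ^ n * star v * (v * v ^ n)"
      by (simp only: power_Suc2[of "star v"] power_Suc[of v])
    also have "\<dots> = star v ^ n * (star v * v) * v ^ n" by (simp only: mult.assoc)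
    finally have "star v ^ Suc n * v ^ Suc n = star v ^ n * (star v * v) * v ^ n" .
    then show ?case using Suc that by simp
  qed simp
  show ?thesis using *[of u] *[of "star u"] assms
    by (simp add: unitary_power_def star_power star_star)
qed

lemma cstar_of_type_simps [simp]:
  "carrier cstar_of_type = UNIV" "mult cstar_of_type = (*)" "one cstar_of_type = 1"
  "zero cstar_of_type = 0" "add cstar_of_type = (+)" "cscale cstar_of_type = scaleC"
  "adj cstar_of_type = star" "cnorm cstar_of_type = norm"
  by (simp_all add: cstar_of_type_def)

locale rotation_algebra =
  fixes \<theta> :: real and U V :: "'a::cstar_algebra"
  assumes universal: "universal_rotation_algebra \<theta> U V"
begin

lemma unitary: "star U * U = 1" "U * star U = 1" "star V * V = 1" "V * star V = 1"
  and commutation: "U * V = exp (2 * pi * \<i> * \<theta>) *\<^sub>C (V * U)"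
  using universal by (auto simp: universal_rotation_algebra_def rotation_pair_def unitary_in_def)

lemma star_monomial_mult_self: "star (monomial U V x) * monomial U V x = 1"
proof -
  obtain m n where x: "x = (m, n)" by fastforce
  have "star (monomial U V x) * monomial U V x = star (unitary_power V n)
      * (star (unitary_power U m) * unitary_power U m) * unitary_power V n"
    by (simp add: x monomial_def star_mult mult.assoc)
  then show ?thesis using unitary unitary_unitary_power[of U] unitary_unitary_power[of V] by simp
qed

lemma norm_monomial: "norm (monomial U V x) = 1"
  using cstar_identity[of "monomial U V x"] norm_ge_zero[of "monomial U V x"]
  by (auto simp del: norm_ge_zero simp add: star_monomial_mult_self power2_eq_1_iff)

lemma monomial_0: "monomial U V (0, 0) = 1"
  by (simp add: monomial_def unitary_power_def)

lemma fourier_has_sum: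
  assumes "rapidly_decreasing c"
  shows "((\<lambda>x. (case x of (m, n) \<Rightarrow> c m n) *\<^sub>C monomial U V x) has_sum fourier_sum U V c) UNIV"
proof -
  have "(\<lambda>x. norm ((case x of (m, n) \<Rightarrow> c m n) *\<^sub>C monomial U V x)) summable_on UNIV"
    using rapidly_decreasing_abs_summable[OF assms, of 0]
    by (simp add: norm_scaleC norm_monomial case_prod_unfold)
  then show ?thesis
    unfolding fourier_sum_monomial by (rule has_sum_infsum[OF abs_summable_summable])
qed

lemma fourier_sum_uminus:
  assumes "rapidly_decreasing c"
  shows "fourier_sum U V (\<lambda>m n. - c m n) = - fourier_sum U V c"
proof -
  have "((\<lambda>x. (case x of (m, n) \<Rightarrow> - c m n) *\<^sub>C monomial U V x) has_sum - fourier_sum U V c) UNIV"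
    using has_sum_uminusI[OF fourier_has_sum[OF assms]]
    by (simp add: scaleC_minus_left case_prod_unfold)
  then show ?thesis
    by (rule has_sum_unique[OF fourier_has_sum[OF rapidly_decreasing_uminus[OF assms]]])
qed

lemma fourier_sum_diff:
  assumes "rapidly_decreasing c" "rapidly_decreasing d"
  shows "fourier_sum U V (\<lambda>m n. c m n - d m n) = fourier_sum U V c - fourier_sum U V d"
proof -
  have "((\<lambda>x. (case x of (m, n) \<Rightarrow> c m n - d m n) *\<^sub>C monomial U V x)
      has_sum (fourier_sum U V c + - fourier_sum U V d)) UNIV"
    using has_sum_add[OF fourier_has_sum[OF assms(1)] has_sum_uminusI[OF fourier_has_sum[OF assms(2)]]]
    by (simp add: scaleC_diff_left case_prod_unfold)
  then show ?thesis
    using has_sum_unique[OF fourier_has_sum[OF rapidly_decreasing_diff[OF assms]]] by simp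
qed

text \<open>
  The elements $e^{is}U$ and $e^{it}V$ satisfy the defining relations, so the universal property,
  with the algebra itself as target, provides a homomorphism of $A_\theta$ to itself taking $U$ and $V$ to them.
\<close>

lemma torus_action:
  "\<exists>\<alpha>. (\<forall>x y. \<alpha> (x + y) = \<alpha> x + \<alpha> y) \<and> (\<forall>x y. \<alpha> (x * y) = \<alpha> x * \<alpha> y) \<and> \<alpha> 1 = 1
    \<and> (\<forall>a x. \<alpha> (a *\<^sub>C x) = a *\<^sub>C \<alpha> x) \<and> (\<forall>x. \<alpha> (star x) = star (\<alpha> x))
    \<and> (\<forall>m n. \<alpha> (monomial U V (m, n)) = cis (s * of_int m + t * of_int n) *\<^sub>C monomial U V (m, n))"
proof -
  have "rotation_pair \<theta> cstar_of_type (cis s *\<^sub>C U) (cis t *\<^sub>C V)"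
  proof -
    have "cis s *\<^sub>C U * cis t *\<^sub>C V = exp (2 * pi * \<i> * \<theta>) *\<^sub>C (cis t *\<^sub>C V * cis s *\<^sub>C U)"
      by (simp only: mult_scaleC_left mult_scaleC_right scaleC_scaleC commutation) (simp add: mult_ac)
    then show ?thesis
      using unitary
      by (simp add: rotation_pair_def unitary_in_def star_scaleC mult_scaleC_left mult_scaleC_right
          scaleC_scaleC cis_cnj cis_mult)
  qed
  then obtain \<alpha> where \<alpha>: "\<alpha> \<in> star_hom cstar_of_type cstar_of_type"
      "\<alpha> U = cis s *\<^sub>C U" "\<alpha> V = cis t *\<^sub>C V"
    using universal unital_cstar_cstar_of_type unfolding universal_rotation_algebra_def by blast
  have add: "\<alpha> (x + y) = \<alpha> x + \<alpha> y" and mult: "\<alpha> (x * y) = \<alpha> x * \<alpha> y" and one: "\<alpha> 1 = 1"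
    and scale: "\<alpha> (a *\<^sub>C x) = a *\<^sub>C \<alpha> x" and star: "\<alpha> (star x) = star (\<alpha> x)" for a x y
    using \<alpha>(1) by (auto simp: star_hom_def ring_hom_def)
  have pow: "\<alpha> (x ^ k) = \<alpha> x ^ k" for x k by (induction k) (auto simp: one mult)
  have scale_pow: "(a *\<^sub>C x) ^ k = a ^ k *\<^sub>C x ^ k" for a k and x :: 'a
    by (induction k) (simp_all add: mult_scaleC_left mult_scaleC_right scaleC_scaleC mult.commute)
  have up: "\<alpha> (unitary_power u m) = cis (r * of_int m) *\<^sub>C unitary_power u m"
    if "\<alpha> u = cis r *\<^sub>C u" for u r m
  proof (cases "0 \<le> m")
    case True
    have "cis r ^ nat m = cis (r * of_int m)"
      unfolding Complex.DeMoivre using True by (simp add: mult.commute)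
    then show ?thesis using True by (simp add: unitary_power_def pow that scale_pow)
  next
    case False
    have "cnj (cis r) ^ nat (- m) = cis (r * of_int m)"
      unfolding cis_cnj Complex.DeMoivre using False by (simp add: mult.commute)
    then show ?thesis using False
      by (simp add: unitary_power_def pow star that star_scaleC scale_pow)
  qed
  have "\<alpha> (monomial U V (m, n)) = cis (s * of_int m + t * of_int n) *\<^sub>C monomial U V (m, n)" for m n
    by (simp add: monomial_def mult up[OF \<alpha>(2)] up[OF \<alpha>(3)] mult_scaleC_left mult_scaleC_right
       scaleC_scaleC cis_mult add.commute)
  then show ?thesis using add mult one scale star by blast
qed

text \<open>
  A $*$-homomorphism maps $x^*x$ to $\alpha(x)^*\alpha(x)$, so composition with it preserves states. The
  products of two monomials serve to read off a single Fourier coefficient; the case $m = n = 0$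
  gives the action on monomials.
\<close>

lemma state_torus_action:
  assumes "state \<phi>"
  shows "\<exists>\<psi>. state \<psi> \<and> (\<forall>m n k l. \<psi> (star (monomial U V (m, n)) * monomial U V (k, l))
    = cis (s * of_int (k - m) + t * of_int (l - n)) * \<phi> (star (monomial U V (m, n)) * monomial U V (k, l)))"
proof -
  obtain \<alpha> where \<alpha>: "\<And>x y. \<alpha> (x + y) = \<alpha> x + \<alpha> y" "\<And>x y. \<alpha> (x * y) = \<alpha> x * \<alpha> y" "\<alpha> 1 = 1"
    "\<And>a x. \<alpha> (a *\<^sub>C x) = a *\<^sub>C \<alpha> x" "\<And>x. \<alpha> (star x) = star (\<alpha> x)"
    "\<And>m n. \<alpha> (monomial U V (m, n)) = cis (s * of_int m + t * of_int n) *\<^sub>C monomial U V (m, n)"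
    using torus_action[of s t] by blast
  have "state (\<lambda>x. \<phi> (\<alpha> x))"
    using stateD[OF assms] \<alpha> by (simp add: state_def)
  moreover have "\<phi> (\<alpha> (star (monomial U V (m, n)) * monomial U V (k, l)))
      = cis (s * of_int (k - m) + t * of_int (l - n)) * \<phi> (star (monomial U V (m, n)) * monomial U V (k, l))"
    for m n k l
    by (simp add: \<alpha> star_scaleC mult_scaleC_left mult_scaleC_right scaleC_scaleC stateD[OF assms]
        cis_cnj cis_mult algebra_simps)
  ultimately show ?thesis by blast
qed

lemma state_fourier:
  assumes "rapidly_decreasing c" "state \<phi>"
  shows "((\<lambda>(k, l). c k l * \<phi> (monomial U V (k, l))) has_sum \<phi> (fourier_sum U V c)) UNIV"
  using has_sum_bounded_linear[OF bounded_linear_state[OF assms(2)] fourier_has_sum[OF assms(1)]]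
  by (simp add: stateD[OF assms(2)] case_prod_unfold)

text \<open>
  For a state $\varphi$ and $W = (U^m V^n)^*$, applying $\varphi\circ\alpha_{s,t}$ to $W$ times the series gives an absolutely
  convergent Fourier series in $(s,t)$ that vanishes identically. Its constant coefficient is
  $c_{m,n}\,\varphi(W U^m V^n) = c_{m,n}$.
\<close>

lemma fourier_sum_eq_0:
  assumes c: "rapidly_decreasing c" and "fourier_sum U V c = 0"
  shows "c m n = 0"
proof -
  obtain \<phi> where \<phi>: "state (\<phi> :: 'a \<Rightarrow> complex)"
    using state_exists_at_upper_bound[of "1::'a"] by auto
  let ?W = "star (monomial U V (m, n))"
  define g where "g x = (case x of (k, l) \<Rightarrow> c k l) * \<phi> (?W * monomial U V x)" for x
  have "cmod (\<phi> (?W * monomial U V x)) \<le> 1" for x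
    using state_norm_le[OF \<phi>, of "?W * monomial U V x"] norm_mult_ineq[of ?W "monomial U V x"]
    by (simp add: norm_star norm_monomial)
  then have "cmod (g x) \<le> (case x of (k, l) \<Rightarrow> cmod (c k l))" for x
    by (auto simp: g_def norm_mult mult_left_le split: prod.split)
  moreover have "(\<lambda>(k, l). cmod (c k l)) summable_on UNIV"
    using rapidly_decreasing_abs_summable[OF c, of 0] by simp
  ultimately have sg: "(\<lambda>x. cmod (g x)) summable_on UNIV"
    by (intro Infinite_Sum.abs_summable_on_comparison_test'[where f = g])
  have "((\<lambda>(k, l). g (k, l) * cis (s * of_int (k - m) + t * of_int (l - n))) has_sum 0) UNIV" for s t
  proof -
    obtain \<psi> where \<psi>: "state \<psi>" "\<And>m n k l. \<psi> (star (monomial U V (m, n)) * monomial U V (k, l))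
      = cis (s * of_int (k - m) + t * of_int (l - n)) * \<phi> (star (monomial U V (m, n)) * monomial U V (k, l))"
      using state_torus_action[OF \<phi>, of s t] by blast
    have "bounded_linear (\<lambda>x. \<psi> (?W * x))"
      by (intro bounded_linear_compose[OF bounded_linear_state[OF \<psi>(1)]] bounded_linear_mult_right)
    from has_sum_bounded_linear[OF this fourier_has_sum[OF c]]
    have "((\<lambda>x. \<psi> (?W * (case x of (m, n) \<Rightarrow> c m n) *\<^sub>C monomial U V x)) has_sum \<psi> (?W * 0)) UNIV"
      by (simp add: assms)
    also have "\<psi> (?W * 0) = 0" using stateD(2)[OF \<psi>(1), of 0 0] by simp
    also have "(\<lambda>x. \<psi> (?W * (case x of (m, n) \<Rightarrow> c m n) *\<^sub>C monomial U V x))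
      = (\<lambda>(k, l). g (k, l) * cis (s * of_int (k - m) + t * of_int (l - n)))"
      by (auto simp: fun_eq_iff mult_scaleC_right stateD(2)[OF \<psi>(1)] \<psi>(2) g_def)
    finally show ?thesis .
  qed
  then have "g (m, n) = 0" by (rule double_fourier_series_zero_coeff[OF sg])
  then show ?thesis by (simp add: g_def star_monomial_mult_self stateD(3)[OF \<phi>])
qed

lemma fourier_coeff_fourier_sum:
  assumes "rapidly_decreasing c"
  shows "fourier_coeff U V (fourier_sum U V c) = c"
  unfolding fourier_coeff_def
proof (rule the_equality)
  fix d assume d: "rapidly_decreasing d \<and> fourier_sum U V d = fourier_sum U V c"
  then have "fourier_sum U V (\<lambda>m n. d m n - c m n) = 0"
    using fourier_sum_diff[of d c] assms by simp
  then have "d m n - c m n = 0" for m n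
    using fourier_sum_eq_0[OF rapidly_decreasing_diff] d assms by blast
  then show "d = c" by (simp add: fun_eq_iff)
qed (use assms in auto)

lemma derivations_fourier_sum:
  assumes "rapidly_decreasing c"
  shows "\<delta>\<^sub>1 U V (fourier_sum U V c) = fourier_sum U V (\<lambda>m n. 2 * pi * \<i> * of_int m * c m n)"
    "\<delta>\<^sub>2 U V (fourier_sum U V c) = fourier_sum U V (\<lambda>m n. 2 * pi * \<i> * of_int n * c m n)"
  by (simp_all only: \<delta>\<^sub>1_def \<delta>\<^sub>2_def fourier_coeff_fourier_sum[OF assms])

lemma laplacian_fourier_sum:
  assumes c: "rapidly_decreasing c"
  shows "laplacian U V (fourier_sum U V c)
    = fourier_sum U V (\<lambda>m n. 2 * pi * \<i> * of_int m * (2 * pi * \<i> * of_int m * c m n))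
    + fourier_sum U V (\<lambda>m n. 2 * pi * \<i> * of_int n * (2 * pi * \<i> * of_int n * c m n))"
  by (simp only: laplacian_def derivations_fourier_sum[OF c]
      derivations_fourier_sum(1)[OF rapidly_decreasing_derivative(1)[OF c]]
      derivations_fourier_sum(2)[OF rapidly_decreasing_derivative(2)[OF c]])

lemma laplacian_uminus:
  assumes c: "rapidly_decreasing c"
  shows "laplacian U V (- fourier_sum U V c) = - laplacian U V (fourier_sum U V c)"
proof -
  have "laplacian U V (fourier_sum U V (\<lambda>m n. - c m n)) = - laplacian U V (fourier_sum U V c)"
    unfolding laplacian_fourier_sum[OF rapidly_decreasing_uminus[OF c]] laplacian_fourier_sum[OF c]
    using fourier_sum_uminus[OF rapidly_decreasing_derivative(1)[OF rapidly_decreasing_derivative(1)[OF c]]]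
      fourier_sum_uminus[OF rapidly_decreasing_derivative(2)[OF rapidly_decreasing_derivative(2)[OF c]]]
    by simp
  then show ?thesis by (simp add: fourier_sum_uminus[OF c])
qed

section \<open>The maximum principle\<close>

text \<open>
  Write $g_{m,n} = c_{m,n}\varphi(U^mV^n)$ and $\kappa = pm + qn$, and let $f(s) = \sum g\, e^{is\kappa}$ be the value at $h$ of
  $\varphi$ moved along the direction $(p,q)$. As $f$ is real with maximum at $0$, the second difference
  $d = (2f(0) - f(s) - f(-s))/s^2$ is a nonnegative real. Termwise it is $g\,(2 - 2\cos s\kappa)/s^2$, which differs
  from $g\kappa^2$ by at most $s^2 |g| \kappa^4$, so $d$ tends to $S$ as $s \to 0$ and $S$ is a nonnegative real, too.
\<close>

lemma second_derivative_at_maximum: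
  fixes p q :: real and \<phi> :: "'a \<Rightarrow> complex"
  assumes c: "rapidly_decreasing c" and h: "h = fourier_sum U V c" "star h = h"
    and \<phi>: "state \<phi>" "Re (\<phi> h) = upper_bound h"
    and S: "((\<lambda>(m, n). (p * of_int m + q * of_int n)\<^sup>2 * (c m n * \<phi> (monomial U V (m, n)))) has_sum S) UNIV"
  shows "S \<in> \<real>" "0 \<le> Re S"
proof -
  define g where "g x = (case x of (m, n) \<Rightarrow> c m n) * \<phi> (monomial U V x)" for x
  define \<kappa> where "\<kappa> x = (case x of (m, n) \<Rightarrow> p * of_int m + q * of_int n)" for x :: "int \<times> int"
  have "cmod (\<phi> (monomial U V x)) \<le> 1" for x
    using state_norm_le[OF \<phi>(1), of "monomial U V x"] by (simp add: norm_monomial)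
  then have g_le: "cmod (g x) \<le> (case x of (k, l) \<Rightarrow> cmod (c k l))" for x
    by (auto simp: g_def norm_mult mult_left_le split: prod.split)
  have \<kappa>_le: "\<bar>\<kappa> (m, n)\<bar> \<le> (\<bar>p\<bar> + \<bar>q\<bar>) * (1 + \<bar>real_of_int m\<bar> + \<bar>real_of_int n\<bar>)" for m n
  proof -
    have "\<bar>\<kappa> (m, n)\<bar> \<le> \<bar>p\<bar> * \<bar>real_of_int m\<bar> + \<bar>q\<bar> * \<bar>real_of_int n\<bar>"
      unfolding \<kappa>_def by (simp add: abs_triangle_ineq flip: abs_mult)
    also have "\<dots> \<le> (\<bar>p\<bar> + \<bar>q\<bar>) * (1 + \<bar>real_of_int m\<bar> + \<bar>real_of_int n\<bar>)"
      by (simp add: algebra_simps)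
    finally show ?thesis .
  qed
  have "(\<lambda>x. cmod (g x) * \<kappa> x ^ 4) summable_on UNIV"
  proof (rule summable_on_comparison_test)
    show "(\<lambda>x. (\<bar>p\<bar> + \<bar>q\<bar>) ^ 4 * (case x of (m, n) \<Rightarrow>
        cmod (c m n) * (1 + \<bar>real_of_int m\<bar> + \<bar>real_of_int n\<bar>) ^ 4)) summable_on UNIV"
      by (intro summable_on_cmult_right rapidly_decreasing_abs_summable c)
    fix x :: "int \<times> int"
    obtain m n where x: "x = (m, n)" by fastforce
    have "cmod (g x) * \<bar>\<kappa> x\<bar> ^ 4
        \<le> cmod (c m n) * ((\<bar>p\<bar> + \<bar>q\<bar>) * (1 + \<bar>real_of_int m\<bar> + \<bar>real_of_int n\<bar>)) ^ 4"
      using g_le[of x] \<kappa>_le[of m n] by (intro mult_mono power_mono) (auto simp: x)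
    then show "cmod (g x) * \<kappa> x ^ 4 \<le> (\<bar>p\<bar> + \<bar>q\<bar>) ^ 4 * (case x of (m, n) \<Rightarrow>
        cmod (c m n) * (1 + \<bar>real_of_int m\<bar> + \<bar>real_of_int n\<bar>) ^ 4)"
      by (simp add: x power_mult_distrib mult_ac)
  qed auto
  then obtain K where K: "((\<lambda>x. cmod (g x) * \<kappa> x ^ 4) has_sum K) UNIV"
    by (auto simp: summable_on_def)
  have K0: "K \<ge> 0" using K by (rule has_sum_nonneg) auto
  have orbit: "\<exists>y\<in>\<real>. Re y \<le> upper_bound h \<and> ((\<lambda>x. g x * cis (s * \<kappa> x)) has_sum y) UNIV" for s
  proof -
    obtain \<psi> where \<psi>: "state \<psi>" "\<And>m n k l. \<psi> (star (monomial U V (m, n)) * monomial U V (k, l))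
      = cis (s * p * of_int (k - m) + s * q * of_int (l - n)) * \<phi> (star (monomial U V (m, n)) * monomial U V (k, l))"
      using state_torus_action[OF \<phi>(1), of "s * p" "s * q"] by blast
    have "\<psi> (monomial U V (k, l)) = cis (s * \<kappa> (k, l)) * \<phi> (monomial U V (k, l))" for k l
      using \<psi>(2)[of 0 0 k l] by (simp add: monomial_0 \<kappa>_def algebra_simps)
    then have "((\<lambda>x. g x * cis (s * \<kappa> x)) has_sum \<psi> h) UNIV"
      using state_fourier[OF c \<psi>(1)] by (simp add: h(1) g_def case_prod_unfold mult_ac)
    then show ?thesis using state_selfadjoint_le[OF \<psi>(1) h(2)] by blast
  qed
  have near: "\<exists>d\<in>\<real>. 0 \<le> Re d \<and> cmod (S - d) \<le> s\<^sup>2 * K" if s: "s > 0" for s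
  proof -
    obtain y where y: "y \<in> \<real>" "Re y \<le> upper_bound h" "((\<lambda>x. g x * cis (s * \<kappa> x)) has_sum y) UNIV"
      using orbit by blast
    obtain z where z: "z \<in> \<real>" "Re z \<le> upper_bound h" "((\<lambda>x. g x * cis ((- s) * \<kappa> x)) has_sum z) UNIV"
      using orbit by blast
    have h0: "(g has_sum \<phi> h) UNIV"
      using state_fourier[OF c \<phi>(1)] by (simp add: h(1) g_def[abs_def] case_prod_unfold)
    define d where "d = (2 * \<phi> h - y - z) / of_real (s\<^sup>2)"
    have "\<phi> h \<in> \<real>" by (rule state_selfadjoint_le[OF \<phi>(1) h(2)])
    then have d: "d \<in> \<real>" "0 \<le> Re d"
      using y z \<phi>(2) s by (auto simp: d_def Re_divide_of_real simp del: of_real_power)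
    have "((\<lambda>x. (2 * g x + - (g x * cis (s * \<kappa> x)) + - (g x * cis ((- s) * \<kappa> x))) * (1 / of_real (s\<^sup>2)))
        has_sum (2 * \<phi> h + - y + - z) * (1 / of_real (s\<^sup>2))) UNIV"
      by (intro has_sum_cmult_left has_sum_add has_sum_uminusI has_sum_cmult_right h0 y z)
    also have "(\<lambda>x. (2 * g x + - (g x * cis (s * \<kappa> x)) + - (g x * cis ((- s) * \<kappa> x))) * (1 / of_real (s\<^sup>2)))
        = (\<lambda>x. g x * of_real ((2 - 2 * cos (s * \<kappa> x)) / s\<^sup>2))"
    proof
      fix x
      have "cis (s * \<kappa> x) + cis ((- s) * \<kappa> x) = of_real (2 * cos (s * \<kappa> x))"
        by (simp add: complex_eq_iff)
      then have "2 * g x + - (g x * cis (s * \<kappa> x)) + - (g x * cis ((- s) * \<kappa> x))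
        = g x * of_real (2 - 2 * cos (s * \<kappa> x))" by (simp add: algebra_simps flip: distrib_left)
      then show "(2 * g x + - (g x * cis (s * \<kappa> x)) + - (g x * cis ((- s) * \<kappa> x))) * (1 / of_real (s\<^sup>2))
        = g x * of_real ((2 - 2 * cos (s * \<kappa> x)) / s\<^sup>2)" by simp
    qed
    also have "(2 * \<phi> h + - y + - z) * (1 / of_real (s\<^sup>2)) = d" by (simp add: d_def)
    finally have D: "((\<lambda>x. g x * of_real ((2 - 2 * cos (s * \<kappa> x)) / s\<^sup>2)) has_sum d) UNIV" .
    have "((\<lambda>x. of_real ((\<kappa> x)\<^sup>2) * g x) has_sum S) UNIV"
      using S by (simp add: g_def \<kappa>_def case_prod_unfold)
    from has_sum_add[OF this has_sum_uminusI[OF D]]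
    have "((\<lambda>x. g x * of_real ((\<kappa> x)\<^sup>2 - (2 - 2 * cos (s * \<kappa> x)) / s\<^sup>2)) has_sum (S - d)) UNIV"
      by (simp add: algebra_simps)
    then have "cmod (S - d) \<le> s\<^sup>2 * K"
    proof (rule norm_infsum_le)
      show "((\<lambda>x. s\<^sup>2 * (cmod (g x) * \<kappa> x ^ 4)) has_sum s\<^sup>2 * K) UNIV"
        by (intro has_sum_cmult_right K)
      fix x
      have "(\<kappa> x)\<^sup>2 - (2 - 2 * cos (s * \<kappa> x)) / s\<^sup>2 = ((s * \<kappa> x)\<^sup>2 - (2 - 2 * cos (s * \<kappa> x))) / s\<^sup>2"
        using s by (simp add: field_simps)
      then have "\<bar>(\<kappa> x)\<^sup>2 - (2 - 2 * cos (s * \<kappa> x)) / s\<^sup>2\<bar> \<le> (s * \<kappa> x) ^ 4 / s\<^sup>2"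
        using cos_second_difference[of "s * \<kappa> x"] s by (simp add: abs_divide divide_right_mono)
      also have "\<dots> = s\<^sup>2 * \<kappa> x ^ 4" using s by (simp add: power_mult_distrib eval_nat_numeral)
      finally show "cmod (g x * of_real ((\<kappa> x)\<^sup>2 - (2 - 2 * cos (s * \<kappa> x)) / s\<^sup>2)) \<le> s\<^sup>2 * (cmod (g x) * \<kappa> x ^ 4)"
        unfolding norm_mult norm_of_real by (simp add: mult.left_commute mult_left_mono)
    qed
    with d show ?thesis by blast
  qed
  have close: "\<exists>d\<in>\<real>. 0 \<le> Re d \<and> cmod (S - d) \<le> e" if "e > 0" for e
  proof -
    define s where "s = sqrt (e / (K + 1))"
    have s: "s > 0" "s\<^sup>2 = e / (K + 1)" using that K0 by (auto simp: s_def)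
    have "s\<^sup>2 * K \<le> s\<^sup>2 * (K + 1)" by (simp add: distrib_left)
    also have "\<dots> = e" using s(2) K0 by simp
    finally have "s\<^sup>2 * K \<le> e" .
    then show ?thesis using near[OF s(1)] by (meson order.trans)
  qed
  have "\<bar>Im S\<bar> \<le> e" "- Re S \<le> e" if "e > 0" for e
  proof -
    obtain d where d: "d \<in> \<real>" "0 \<le> Re d" "cmod (S - d) \<le> e" using close[OF \<open>e > 0\<close>] by blast
    show "\<bar>Im S\<bar> \<le> e" "- Re S \<le> e"
      using d abs_Im_le_cmod[of "S - d"] abs_Re_le_cmod[of "S - d"] by (auto simp: complex_is_Real_iff)
  qed
  then have "\<bar>Im S\<bar> \<le> 0" "- Re S \<le> 0"
    using field_le_epsilon[of "\<bar>Im S\<bar>" 0] field_le_epsilon[of "- Re S" 0] by simp_all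
  then show "S \<in> \<real>" "0 \<le> Re S" by (auto simp: complex_is_Real_iff)
qed

text \<open>
  The Laplacian multiplies $c_{m,n}$ by $-4\pi^2(m^2 + n^2)$, so the two coordinate directions of the previous
  lemma suffice.
\<close>

lemma laplacian_at_maximum:
  assumes c: "rapidly_decreasing c" and h: "h = fourier_sum U V c" "star h = h"
    and \<phi>: "state \<phi>" "Re (\<phi> h) = upper_bound h"
  shows "\<phi> (laplacian U V h) \<in> \<real>" "Re (\<phi> (laplacian U V h)) \<le> 0"
proof -
  \<comment> \<open>The factor that turns \<open>(2 * pi * \<i> * m)\<^sup>2\<close> into \<open>m\<^sup>2\<close>.\<close>
  define r where "r = - inverse (4 * pi\<^sup>2)"
  have r: "complex_of_real r * (2 * pi * \<i> * (a * (2 * pi * \<i> * b))) = a * b" for a b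
    by (simp add: r_def power2_eq_square field_simps)
  have m: "((\<lambda>(m, n). 2 * pi * \<i> * of_int m * (2 * pi * \<i> * of_int m * c m n) * \<phi> (monomial U V (m, n))) has_sum
      \<phi> (fourier_sum U V (\<lambda>m n. 2 * pi * \<i> * of_int m * (2 * pi * \<i> * of_int m * c m n)))) UNIV"
    (is "(?f has_sum ?x) _")
    using state_fourier[OF rapidly_decreasing_derivative(1)[OF rapidly_decreasing_derivative(1)[OF c]] \<phi>(1)] .
  have n: "((\<lambda>(m, n). 2 * pi * \<i> * of_int n * (2 * pi * \<i> * of_int n * c m n) * \<phi> (monomial U V (m, n))) has_sum
      \<phi> (fourier_sum U V (\<lambda>m n. 2 * pi * \<i> * of_int n * (2 * pi * \<i> * of_int n * c m n)))) UNIV"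
    (is "(?g has_sum ?y) _")
    using state_fourier[OF rapidly_decreasing_derivative(2)[OF rapidly_decreasing_derivative(2)[OF c]] \<phi>(1)] .
  have "(\<lambda>x. complex_of_real r * ?f x)
      = (\<lambda>(m, n). (1 * of_int m + 0 * of_int n)\<^sup>2 * (c m n * \<phi> (monomial U V (m, n))))"
    using r by (auto simp: fun_eq_iff mult.assoc power2_eq_square)
  with has_sum_cmult_right[OF m, of "of_real r"]
  have x: "of_real r * ?x \<in> \<real>" "0 \<le> Re (of_real r * ?x)"
    using second_derivative_at_maximum[OF c h \<phi>, of 1 0 "of_real r * ?x"] by simp_all
  have "(\<lambda>x. complex_of_real r * ?g x)
      = (\<lambda>(m, n). (0 * of_int m + 1 * of_int n)\<^sup>2 * (c m n * \<phi> (monomial U V (m, n))))"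
    using r by (auto simp: fun_eq_iff mult.assoc power2_eq_square)
  with has_sum_cmult_right[OF n, of "of_real r"]
  have y: "of_real r * ?y \<in> \<real>" "0 \<le> Re (of_real r * ?y)"
    using second_derivative_at_maximum[OF c h \<phi>, of 0 1 "of_real r * ?y"] by simp_all
  have r0: "r < 0" by (simp add: r_def)
  have "\<phi> (laplacian U V h) = ?x + ?y"
    unfolding h(1) laplacian_fourier_sum[OF c] by (rule stateD(1)[OF \<phi>(1)])
  with x y r0 show "\<phi> (laplacian U V h) \<in> \<real>" "Re (\<phi> (laplacian U V h)) \<le> 0"
    by (auto simp: complex_is_Real_iff zero_le_mult_iff)
qed

end

theorem proposition2p9:
  fixes \<theta> :: real and U V h :: "'a::cstar_algebra"
  assumes "\<theta> \<notin> \<rat>"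
    and "universal_rotation_algebra \<theta> U V"
    and "h \<in> smooth_subalgebra U V"
    and "star h = h"
  shows "(\<exists>t0 t1. smallest_spectral_interval h t0 t1) \<and>
    (\<forall>t0 t1. smallest_spectral_interval h t0 t1 \<longrightarrow>
      complex_of_real t1 \<in> spectrum h \<and> (\<forall>t. complex_of_real t \<in> spectrum h \<longrightarrow> t \<le> t1) \<and>
      complex_of_real t0 \<in> spectrum h \<and> (\<forall>t. complex_of_real t \<in> spectrum h \<longrightarrow> t0 \<le> t) \<and>
      (\<exists>\<phi>. state \<phi> \<and> \<phi> h = complex_of_real t1) \<and>
      (\<forall>\<phi>. state \<phi> \<and> \<phi> h = complex_of_real t1 \<longrightarrow>
        \<phi> (laplacian U V h) \<in> \<real> \<and> Re (\<phi> (laplacian U V h)) \<le> 0) \<and>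
      (\<exists>\<psi>. state \<psi> \<and> \<psi> h = complex_of_real t0) \<and>
      (\<forall>\<psi>. state \<psi> \<and> \<psi> h = complex_of_real t0 \<longrightarrow>
        \<psi> (laplacian U V h) \<in> \<real> \<and> Re (\<psi> (laplacian U V h)) \<ge> 0))"
proof -
  interpret rotation_algebra \<theta> U V by unfold_locales (rule assms(2))
  obtain c where c: "rapidly_decreasing c" "h = fourier_sum U V c"
    using assms(3) by (auto simp: smooth_subalgebra_def)
  note c' = rapidly_decreasing_uminus[OF c(1)]
  have mh: "- h = fourier_sum U V (\<lambda>m n. - c m n)" by (simp add: fourier_sum_uminus c)
  have h': "star (- h) = - h" using assms(4) by (simp add: star_minus)
  show ?thesis
    unfolding smallest_spectral_interval_iff[OF assms(4)]
  proof (intro conjI allI impI; (elim conjE)?; (hypsubst)?)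
    show "complex_of_real (upper_bound h) \<in> spectrum h"
      by (rule upper_bound_in_spectrum[OF assms(4)])
    show "complex_of_real (- upper_bound (- h)) \<in> spectrum h"
      using upper_bound_in_spectrum[OF h'] unfolding spectrum_minus .
    show "t \<le> upper_bound h" if "complex_of_real t \<in> spectrum h" for t
      by (rule spectrum_le_upper_bound[OF assms(4) that])
    show "- upper_bound (- h) \<le> t" if "complex_of_real t \<in> spectrum h" for t
      using spectrum_le_upper_bound[OF h', of "- t"] that unfolding spectrum_minus by simp
    show "\<exists>\<phi>. state \<phi> \<and> \<phi> h = complex_of_real (upper_bound h)"
      using state_exists_at_upper_bound[OF assms(4)] by metis
    obtain \<psi> where "state \<psi>" "\<psi> (- h) = complex_of_real (upper_bound (- h))"
      using state_exists_at_upper_bound[OF h'] .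
    then show "\<exists>\<psi>. state \<psi> \<and> \<psi> h = complex_of_real (- upper_bound (- h))"
      using state_minus[of \<psi> h] by (metis minus_minus of_real_minus)
    show "\<phi> (laplacian U V h) \<in> \<real>" "Re (\<phi> (laplacian U V h)) \<le> 0"
      if "state \<phi>" "\<phi> h = complex_of_real (upper_bound h)" for \<phi>
      using laplacian_at_maximum[OF c assms(4) that(1)] that by simp_all
    show "\<psi> (laplacian U V h) \<in> \<real>" "Re (\<psi> (laplacian U V h)) \<ge> 0"
      if "state \<psi>" "\<psi> h = complex_of_real (- upper_bound (- h))" for \<psi>
      using laplacian_at_maximum[OF c' mh h' that(1)] that
        laplacian_uminus[OF c(1)] c(2) state_minus[OF that(1), of h]
        state_minus[OF that(1), of "laplacian U V h"]
      by (simp_all add: complex_is_Real_iff)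
  qed auto
qed

end
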